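(* Fix $A\in\{(123),(124),(134),(234)\}$, integers $r_A\ge1$, $k\ge0$, and $\zeta>0$. The closure of the moduli space $\mathfrak M_{r_A,k}^{\mathsf T_A}$ of $\mathsf T_A$-invariant noncommutative instantons of rank $r_A$ and charge $k$ on $\mathbb C^3_A$ is compact.
   Context: Let $\bar A$ be the element of $\{1,2,3,4\}$ not in $A$. Let $V$ and $W_A$ be Hermitian vector spaces of complex dimensions $k$ and $r_A$. ADHM data are tuples $(B_a,I_A)_{a=1,\dots,4}$ with $B_a\in\mathrm{End}_{\mathbb C}(V)$, $I_A\in\mathrm{Hom}_{\mathbb C}(W_A,V)$. The ADHM equations are $$[B_a,B_b]-\tfrac12\sum_{c,d}\varepsilon_{abcd}[B_c^\dagger,B_d^\dagger]=0\ \ (1\le a<b\le 4),\qquad \sum_{a=1}^4[B_a,B_a^\dagger]+I_AI_A^\dagger=\zeta\,\mathrm{id}_V,\qquad B_{\bar A}I_A=0,$$ where $\varepsilon_{abcd}$ is the Levi-Civita symbol with $\varepsilon_{1234}=1$. The group $U(k)=U(V)$ acts by $g\cdot(B_a,I_A)=(gB_ag^{-1},gI_A)$. The moduli space $\mathfrak M_{r_A,k}$ of noncommutative instantons of rank $r_A$ and charge $k$ on $\mathbb C^3_A$ is the set of $U(k)$-orbits of solutions, with the topology induced by the Frobenius norm on the affine space of ADHM data (closures are taken in the orbit space of this affine space by $U(k)$). The torus $\mathsf T_A=U(1)^{r_A}\times U(1)$ acts on ADHM data, and hence on $\mathfrak M_{r_A,k}$, by $$B_a\mapsto t^{-1}B_a\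 (a\in A),\qquad B_{\bar A}\mapsto t^{3}B_{\bar A},\qquad I_A\mapsto I_A\,h,$$ where $t\in U(1)$ and $h\in U(1)^{r_A}$ is a diagonal unitary matrix acting on $W_A\cong\mathbb C^{r_A}$. $\mathfrak M_{r_A,k}^{\mathsf T_A}\subset\mathfrak M_{r_A,k}$ is the set of points fixed by $\mathsf T_A$. *)

theory Defs
  imports
    "HOL-Analysis.Abstract_Metric_Spaces"
    "HOL-Analysis.L2_Norm"
    "Jordan_Normal_Form.Schur_Decomposition"
begin

text \<open>
  Orthonormal bases identify \<open>V\<close> with \<open>\<complex>^k\<close> and \<open>W\<close> with \<open>\<complex>^r\<close>. An ADHM datum is a pair
  \<open>(B, I)\<close>, where \<open>B a\<close> (\<open>a = 1, \<dots>, 4\<close>) is a \<open>k \<times> k\<close> matrix and \<open>I\<close> is a \<open>k \<times> r\<close> matrix.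
  The Hermitian adjoint is the library's \<^const>\<open>mat_adjoint\<close>.
\<close>

type_synonym adhm = "(nat \<Rightarrow> complex mat) \<times> complex mat"

definition adhm_space :: "nat \<Rightarrow> nat \<Rightarrow> adhm set" where
  "adhm_space k r = ({1..4} \<rightarrow>\<^sub>E carrier_mat k k) \<times> carrier_mat k r"


subsection \<open>The ADHM equations\<close>

definition levi_civita :: "nat \<Rightarrow> nat \<Rightarrow> nat \<Rightarrow> nat \<Rightarrow> int" where
  "levi_civita a b c d =
     (let s = (\<lambda>i j. sgn (int j - int i)) in s a b * s a c * s a d * s b c * s b d * s c d)"

lemma levi_civita_1234: "levi_civita 1 2 3 4 = 1"
  by (simp add: levi_civita_def)

lemma levi_civita_swap:
  "levi_civita b a c d = - levi_civita a b c d"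
  "levi_civita a c b d = - levi_civita a b c d"
  "levi_civita a b d c = - levi_civita a b c d"
proof -
  have s: "sgn (int i - int j) = - sgn (int j - int i)" for i j
    by (simp add: sgn_if)
  show "levi_civita b a c d = - levi_civita a b c d"
    by (simp add: levi_civita_def s[of a b] ac_simps)
  show "levi_civita a c b d = - levi_civita a b c d"
    by (simp add: levi_civita_def s[of b c] ac_simps)
  show "levi_civita a b d c = - levi_civita a b c d"
    by (simp add: levi_civita_def s[of c d] ac_simps)
qed

definition mat_comm :: "complex mat \<Rightarrow> complex mat \<Rightarrow> complex mat" where
  "mat_comm X Y = X * Y - Y * X"

text \<open>Matrices of varying dimensions do not form a \<^class>\<open>comm_monoid_add\<close>, so that \<^const>\<open>sum\<close> is only
  available entrywise.\<close>

definition mat_sum :: "nat \<Rightarrow> ('i \<Rightarrow> complex mat) \<Rightarrow> 'i set \<Rightarrow> complex mat" where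
  "mat_sum k f S = mat k k (\<lambda>(i, j). \<Sum>s\<in>S. f s $$ (i, j))"

definition missing_index :: "nat set \<Rightarrow> nat" where
  "missing_index A = (THE a. a \<in> {1..4} \<and> a \<notin> A)"

definition adhm_solutions :: "nat set \<Rightarrow> nat \<Rightarrow> nat \<Rightarrow> real \<Rightarrow> adhm set" where
  "adhm_solutions A r k \<zeta> = {(B, I). (B, I) \<in> adhm_space k r \<and>
     (\<forall>a b. 1 \<le> a \<and> a < b \<and> b \<le> 4 \<longrightarrow>
        mat_comm (B a) (B b) - (1/2) \<cdot>\<^sub>m
          mat_sum k (\<lambda>(c, d). of_int (levi_civita a b c d) \<cdot>\<^sub>m
                      mat_comm (mat_adjoint (B c)) (mat_adjoint (B d))) ({1..4} \<times> {1..4})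
        = 0\<^sub>m k k) \<and>
     mat_sum k (\<lambda>a. mat_comm (B a) (mat_adjoint (B a))) {1..4} + I * mat_adjoint I
       = complex_of_real \<zeta> \<cdot>\<^sub>m 1\<^sub>m k \<and>
     B (missing_index A) * I = 0\<^sub>m k r}"


subsection \<open>The orbit space\<close>

definition unitary_group :: "nat \<Rightarrow> complex mat set" where
  "unitary_group n =
     {g \<in> carrier_mat n n. g * mat_adjoint g = 1\<^sub>m n \<and> mat_adjoint g * g = 1\<^sub>m n}"

text \<open>For unitary \<open>g\<close> the inverse \<open>g\<^sup>-\<^sup>1\<close> is \<^term>\<open>mat_adjoint g\<close>.\<close>

definition gauge_act :: "complex mat \<Rightarrow> adhm \<Rightarrow> adhm" where
  "gauge_act g = (\<lambda>(B, I). (\<lambda>a\<in>{1..4}. g * B a * mat_adjoint g, g * I))"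

definition adhm_orbit :: "nat \<Rightarrow> adhm \<Rightarrow> adhm set" where
  "adhm_orbit k x = (\<lambda>g. gauge_act g x) ` unitary_group k"

definition frob_dist :: "nat \<Rightarrow> nat \<Rightarrow> complex mat \<Rightarrow> complex mat \<Rightarrow> real" where
  "frob_dist m n X Y = sqrt (\<Sum>i<m. \<Sum>j<n. (cmod (X $$ (i, j) - Y $$ (i, j)))\<^sup>2)"

definition adhm_dist :: "nat \<Rightarrow> nat \<Rightarrow> adhm \<Rightarrow> adhm \<Rightarrow> real" where
  "adhm_dist k r = (\<lambda>(B, I) (B', I').
     sqrt ((\<Sum>a\<in>{1..4}. (frob_dist k k (B a) (B' a))\<^sup>2) + (frob_dist k r I I')\<^sup>2))"

lemma frob_dist_L2:
  "frob_dist m n X Y = L2_set (\<lambda>p. cmod (X $$ p - Y $$ p)) ({..<m} \<times> {..<n})"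
  by (simp add: frob_dist_def L2_set_def sum.cartesian_product split_def)

lemma frob_dist_nonneg: "0 \<le> frob_dist m n X Y"
  by (simp add: frob_dist_L2)

lemma frob_dist_commute: "frob_dist m n X Y = frob_dist m n Y X"
  by (simp add: frob_dist_def norm_minus_commute)

lemma frob_dist_triangle: "frob_dist m n X Z \<le> frob_dist m n X Y + frob_dist m n Y Z"
proof -
  have "frob_dist m n X Z \<le>
      L2_set (\<lambda>p. cmod (X $$ p - Y $$ p) + cmod (Y $$ p - Z $$ p)) ({..<m} \<times> {..<n})"
    unfolding frob_dist_L2
    by (intro L2_set_mono) (auto intro: norm_diff_triangle_le)
  also have "\<dots> \<le> frob_dist m n X Y + frob_dist m n Y Z"
    unfolding frob_dist_L2 by (rule L2_set_triangle_ineq)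
  finally show ?thesis .
qed

lemma frob_dist_eq_0:
  assumes "X \<in> carrier_mat m n" "Y \<in> carrier_mat m n"
  shows "frob_dist m n X Y = 0 \<longleftrightarrow> X = Y"
proof
  assume "frob_dist m n X Y = 0"
  then have "\<forall>p\<in>{..<m} \<times> {..<n}. cmod (X $$ p - Y $$ p) = 0"
    by (simp add: frob_dist_L2 L2_set_eq_0_iff)
  then show "X = Y" using assms by (intro eq_matI) auto
qed (simp add: frob_dist_def)

lemma adhm_dist_L2:
  "adhm_dist k r (B, I) (B', I') =
     sqrt ((L2_set (\<lambda>a. frob_dist k k (B a) (B' a)) {1..4})\<^sup>2 + (frob_dist k r I I')\<^sup>2)"
  by (simp add: adhm_dist_def L2_set_def sum_nonneg)

lemma Metric_space_adhm: "Metric_space (adhm_space k r) (adhm_dist k r)"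
proof
  show "0 \<le> adhm_dist k r x y" for x y
    by (cases x; cases y) (simp add: adhm_dist_L2)
  show "adhm_dist k r x y = adhm_dist k r y x" for x y
    by (cases x; cases y) (simp add: adhm_dist_def frob_dist_commute)
next
  fix x y assume xy: "x \<in> adhm_space k r" "y \<in> adhm_space k r"
  obtain B I B' I' where [simp]: "x = (B, I)" "y = (B', I')" by (cases x; cases y)
  have "adhm_dist k r x y = 0 \<longleftrightarrow>
      (\<forall>a\<in>{1..4}. frob_dist k k (B a) (B' a) = 0) \<and> frob_dist k r I I' = 0"
    by (simp add: adhm_dist_L2 sum_power2_eq_zero_iff L2_set_eq_0_iff)
  also have "\<dots> \<longleftrightarrow> (\<forall>a\<in>{1..4}. B a = B' a) \<and> I = I'"
  proof -
    have "frob_dist k k (B a) (B' a) = 0 \<longleftrightarrow> B a = B' a" if "a \<in> {1..4}" for a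
      using xy that by (intro frob_dist_eq_0) (auto simp: adhm_space_def)
    moreover have "frob_dist k r I I' = 0 \<longleftrightarrow> I = I'"
      using xy by (intro frob_dist_eq_0) (auto simp: adhm_space_def)
    ultimately show ?thesis by blast
  qed
  also have "\<dots> \<longleftrightarrow> x = y"
    using xy by (auto simp: adhm_space_def intro: PiE_ext)
  finally show "adhm_dist k r x y = 0 \<longleftrightarrow> x = y" .
next
  fix x y z :: adhm
  obtain B I B' I' B'' I'' where [simp]: "x = (B, I)" "y = (B', I')" "z = (B'', I'')"
    by (cases x; cases y; cases z)
  let ?L = "\<lambda>B B'. L2_set (\<lambda>a. frob_dist k k (B a) (B' a)) {1..4}"
  have "?L B B'' \<le> L2_set (\<lambda>a. frob_dist k k (B a) (B' a) + frob_dist k k (B' a) (B'' a)) {1..4}"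
    by (intro L2_set_mono frob_dist_triangle frob_dist_nonneg)
  also have "\<dots> \<le> ?L B B' + ?L B' B''" by (rule L2_set_triangle_ineq)
  finally have "adhm_dist k r x z \<le>
      sqrt ((?L B B' + ?L B' B'')\<^sup>2 + (frob_dist k r I I' + frob_dist k r I' I'')\<^sup>2)"
    by (auto simp: adhm_dist_L2 frob_dist_nonneg intro!: add_mono power_mono frob_dist_triangle)
  also have "\<dots> \<le> adhm_dist k r x y + adhm_dist k r y z"
    by (simp add: adhm_dist_L2 real_sqrt_sum_squares_triangle_ineq)
  finally show "adhm_dist k r x z \<le> adhm_dist k r x y + adhm_dist k r y z" .
qed

definition adhm_topology :: "nat \<Rightarrow> nat \<Rightarrow> adhm topology" where
  "adhm_topology k r = Metric_space.mtopology (adhm_space k r) (adhm_dist k r)"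

definition orbit_topology :: "nat \<Rightarrow> nat \<Rightarrow> adhm set topology" where
  "orbit_topology k r = topology (\<lambda>U. U \<subseteq> adhm_orbit k ` adhm_space k r \<and>
     openin (adhm_topology k r) {x \<in> adhm_space k r. adhm_orbit k x \<in> U})"

lemma topspace_adhm_topology: "topspace (adhm_topology k r) = adhm_space k r"
  by (simp add: adhm_topology_def Metric_space.topspace_mtopology[OF Metric_space_adhm])

lemma openin_orbit_topology:
  "openin (orbit_topology k r) U \<longleftrightarrow> U \<subseteq> adhm_orbit k ` adhm_space k r \<and>
     openin (adhm_topology k r) {x \<in> adhm_space k r. adhm_orbit k x \<in> U}"
proof -
  let ?P = "\<lambda>U. {x \<in> adhm_space k r. adhm_orbit k x \<in> U}"
  have "?P (S \<inter> T) = ?P S \<inter> ?P T" for S T by auto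
  moreover have "?P (\<Union>K) = \<Union>(?P ` K)" for K by auto
  ultimately have "istopology (\<lambda>U. U \<subseteq> adhm_orbit k ` adhm_space k r \<and> openin (adhm_topology k r) (?P U))"
    unfolding istopology_def by (auto simp del: Union_iff)
  then show ?thesis by (simp add: orbit_topology_def)
qed

lemma topspace_orbit_topology: "topspace (orbit_topology k r) = adhm_orbit k ` adhm_space k r"
proof
  show "topspace (orbit_topology k r) \<subseteq> adhm_orbit k ` adhm_space k r"
    by (auto simp: topspace_def openin_orbit_topology)
  have "{x \<in> adhm_space k r. adhm_orbit k x \<in> adhm_orbit k ` adhm_space k r}
      = topspace (adhm_topology k r)"
    by (auto simp: topspace_adhm_topology)
  then have "openin (orbit_topology k r) (adhm_orbit k ` adhm_space k r)"
    by (simp add: openin_orbit_topology)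
  then show "adhm_orbit k ` adhm_space k r \<subseteq> topspace (orbit_topology k r)"
    by (rule openin_subset)
qed

lemma quotient_map_adhm_orbit:
  "quotient_map (adhm_topology k r) (orbit_topology k r) (adhm_orbit k)"
  by (simp add: quotient_map_def topspace_adhm_topology topspace_orbit_topology
      openin_orbit_topology)

definition moduli_space :: "nat set \<Rightarrow> nat \<Rightarrow> nat \<Rightarrow> real \<Rightarrow> adhm set set" where
  "moduli_space A r k \<zeta> = adhm_orbit k ` adhm_solutions A r k \<zeta>"


subsection \<open>Torus-invariant instantons\<close>

definition torus :: "nat \<Rightarrow> (complex mat \<times> complex) set" where
  "torus r = {h \<in> unitary_group r. diagonal_mat h} \<times> {t. cmod t = 1}"

definition torus_act :: "nat set \<Rightarrow> complex mat \<times> complex \<Rightarrow> adhm \<Rightarrow> adhm" where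
  "torus_act A = (\<lambda>(h, t) (B, I).
     (\<lambda>a\<in>{1..4}. (if a \<in> A then inverse t else t ^ 3) \<cdot>\<^sub>m B a, I * h))"

text \<open>The torus action commutes with the gauge action, so the induced action on an orbit is the
  image of the orbit.\<close>

definition invariant_moduli_space :: "nat set \<Rightarrow> nat \<Rightarrow> nat \<Rightarrow> real \<Rightarrow> adhm set set" where
  "invariant_moduli_space A r k \<zeta> =
     {X \<in> moduli_space A r k \<zeta>. \<forall>\<tau>\<in>torus r. torus_act A \<tau> ` X = X}"

end

(*
  By the ADHM equations the squared norms of [B_1,B_2], [B_1,B_3], [B_1,B_4] add up to a trace
  that vanishes by the Jacobi identity, so the matrices B_a of a solution commute. Stability, V =
  C[B] I(W), follows from the trace of the moment map equation over the complement of an invariant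
  subspace; since B I = 0 for the missing index, that B vanishes. At a fixed point a unitary g
  implements the scaling by a primitive (k + 1)-th root of unity. Its eigenspaces grade V so that
  every B_a has degree one and I(W) has degree zero, and by stability only degrees below k occur.
  The trace of the moment map equation weighted with the degree bounds |B|^2 by zeta k^2, and its
  unweighted trace gives |I|^2 = zeta k. Hence the fixed locus lies in the image of a closed ball,
  which is compact, and closed because the norm is gauge invariant.
*)

theory Submission
  imports Defs "Jordan_Normal_Form.Spectral_Radius" "HOL-Analysis.Function_Topology"
begin

text \<open>The obstacle is the weight of the missing index: a torus element that scales the other
  three matrices by u scales this one by u^-3. If it survived, it would lower the degree by three,
  and the weighted trace would control only a difference of squared norms. Commutativity is what
  removes it: the kernel of this matrix becomes an invariant subspace that contains I(W), so
  stability makes it all of V. The gauge transformations at a fixed point are not assembled into a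
  representation of the torus; one torus element is enough. A root of unity gives a priori only a
  cyclic grading, and its order k + 1 exceeds the dimension so that some degree is empty and the
  grading cannot wrap around. Both subspace arguments become statements about index sets once a
  normal matrix is unitarily diagonalised: B^* B for the kernel, g for the grading. In such a basis
  the diagonal entries of the moment map equation suffice.\<close>

lemma mat_adjoint_dim [simp]:
  "dim_row (mat_adjoint X) = dim_col X" "dim_col (mat_adjoint X) = dim_row X"
  by (simp_all add: mat_adjoint_def)

lemma mat_adjoint_carrier [simp]: "mat_adjoint X \<in> carrier_mat n m \<longleftrightarrow> X \<in> carrier_mat m n"
  by (metis carrier_matD carrier_matI mat_adjoint_dim)

lemma mat_adjoint_index [simp]:
  fixes X :: "complex mat"
  shows "i < dim_col X \<Longrightarrow> j < dim_row X \<Longrightarrow> mat_adjoint X $$ (i, j) = cnj (X $$ (j, i))"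
  by (simp add: mat_adjoint_def mat_of_rows_index)

lemma mat_mult_index:
  assumes "X \<in> carrier_mat m n" "Y \<in> carrier_mat n p" "i < m" "j < p"
  shows "(X * Y) $$ (i, j) = (\<Sum>l<n. X $$ (i, l) * Y $$ (l, j))"
  using assms by (simp add: scalar_prod_def atLeast0LessThan)

lemma mat_adjoint_adjoint [simp]: "mat_adjoint (mat_adjoint X) = (X :: complex mat)"
  by (intro eq_matI) auto

lemma mat_adjoint_mult:
  fixes X :: "complex mat"
  assumes "X \<in> carrier_mat m n" "Y \<in> carrier_mat n p"
  shows "mat_adjoint (X * Y) = mat_adjoint Y * mat_adjoint X"
proof (intro eq_matI)
  fix i j assume "i < dim_row (mat_adjoint Y * mat_adjoint X)" "j < dim_col (mat_adjoint Y * mat_adjoint X)"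
  then have ij: "i < p" "j < m" using assms by auto
  have "mat_adjoint (X * Y) $$ (i, j) = cnj (\<Sum>l<n. X $$ (j, l) * Y $$ (l, i))"
    using assms ij by (subst mat_adjoint_index) (auto simp del: index_mult_mat(1) simp: mat_mult_index)
  also have "\<dots> = (\<Sum>l<n. mat_adjoint Y $$ (i, l) * mat_adjoint X $$ (l, j))"
    using assms ij by (auto intro!: sum.cong)
  also have "\<dots> = (mat_adjoint Y * mat_adjoint X) $$ (i, j)"
    using assms ij by (subst mat_mult_index[of _ p n _ m]) auto
  finally show "mat_adjoint (X * Y) $$ (i, j) = (mat_adjoint Y * mat_adjoint X) $$ (i, j)" .
qed (use assms in auto)

lemma mat_adjoint_one [simp]: "mat_adjoint (1\<^sub>m n :: complex mat) = 1\<^sub>m n"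
  by (intro eq_matI) auto

section \<open>Unitary matrices\<close>

lemma unitary_groupD:
  assumes "g \<in> unitary_group n"
  shows "g \<in> carrier_mat n n" "g * mat_adjoint g = 1\<^sub>m n" "mat_adjoint g * g = 1\<^sub>m n"
  using assms by (auto simp: unitary_group_def)

text \<open>For square matrices a right inverse is also a left inverse.\<close>

lemma unitary_groupI:
  assumes "g \<in> carrier_mat n n" "g * mat_adjoint g = 1\<^sub>m n"
  shows "g \<in> unitary_group n"
  using assms mat_mult_left_right_inverse[of g n "mat_adjoint g"] by (auto simp: unitary_group_def)

lemma one_in_unitary_group [simp]: "1\<^sub>m n \<in> unitary_group n"
  by (auto simp: unitary_group_def)

lemma adjoint_in_unitary_group: "g \<in> unitary_group n \<Longrightarrow> mat_adjoint g \<in> unitary_group n"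
  by (auto simp: unitary_group_def)

lemma unitary_cancel:
  assumes "g \<in> unitary_group n" "X \<in> carrier_mat n m" "Y \<in> carrier_mat p n"
  shows "mat_adjoint g * (g * X) = X" "g * (mat_adjoint g * X) = X"
    "Y * g * mat_adjoint g = Y" "Y * mat_adjoint g * g = Y"
proof -
  note g = unitary_groupD[OF assms(1)]
  have g': "mat_adjoint g \<in> carrier_mat n n" using g(1) by simp
  show "mat_adjoint g * (g * X) = X"
    using assoc_mult_mat[OF g' g(1) assms(2)] g assms(2) by simp
  show "g * (mat_adjoint g * X) = X"
    using assoc_mult_mat[OF g(1) g' assms(2)] g assms(2) by simp
  show "Y * g * mat_adjoint g = Y"
    using assoc_mult_mat[OF assms(3) g(1) g'] g assms(3) by simp
  show "Y * mat_adjoint g * g = Y"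
    using assoc_mult_mat[OF assms(3) g' g(1)] g assms(3) by simp
qed

lemma unitary_mult:
  assumes "g \<in> unitary_group n" "h \<in> unitary_group n"
  shows "g * h \<in> unitary_group n"
proof (rule unitary_groupI)
  note g = unitary_groupD[OF assms(1)] and h = unitary_groupD[OF assms(2)]
  show c: "g * h \<in> carrier_mat n n" using g h by auto
  have "g * h * mat_adjoint (g * h) = g * h * (mat_adjoint h * mat_adjoint g)"
    using g h by (subst mat_adjoint_mult) auto
  also have "\<dots> = g * h * mat_adjoint h * mat_adjoint g"
    using g h by (intro assoc_mult_mat[OF c, symmetric]) auto
  also have "\<dots> = 1\<^sub>m n"
    using g(2) unitary_cancel(3)[OF assms(2) g(1) g(1)] by simp
  finally show "g * h * mat_adjoint (g * h) = 1\<^sub>m n" .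
qed

section \<open>Conjugation by a unitary matrix\<close>

definition conj_by :: "complex mat \<Rightarrow> complex mat \<Rightarrow> complex mat" where
  "conj_by g X = g * X * mat_adjoint g"

lemma conj_by_carrier [simp]:
  "g \<in> carrier_mat n n \<Longrightarrow> X \<in> carrier_mat n n \<Longrightarrow> conj_by g X \<in> carrier_mat n n"
  by (auto simp: conj_by_def)

lemma conj_by_mult:
  assumes "g \<in> unitary_group n" "X \<in> carrier_mat n n" "Y \<in> carrier_mat n n"
  shows "conj_by g (X * Y) = conj_by g X * conj_by g Y"
proof -
  note g = unitary_groupD[OF assms(1)]
  have g': "mat_adjoint g \<in> carrier_mat n n" using g by simp
  have "conj_by g X * conj_by g Y = g * X * (mat_adjoint g * (g * (Y * mat_adjoint g)))"
    unfolding conj_by_def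
    using assoc_mult_mat[OF mult_carrier_mat[OF g(1) assms(2)] g' mult_carrier_mat[OF mult_carrier_mat[OF g(1) assms(3)] g']]
      assoc_mult_mat[OF g(1) assms(3) g'] by simp
  also have "mat_adjoint g * (g * (Y * mat_adjoint g)) = Y * mat_adjoint g"
    using g' assms by (intro unitary_cancel(1)[OF assms(1) _ g(1)]) auto
  also have "g * X * (Y * mat_adjoint g) = g * X * Y * mat_adjoint g"
    using assoc_mult_mat[OF mult_carrier_mat[OF g(1) assms(2)] assms(3) g'] by simp
  also have "\<dots> = conj_by g (X * Y)"
    unfolding conj_by_def using assoc_mult_mat[OF g(1) assms(2,3)] by simp
  finally show ?thesis ..
qed

lemma conj_by_adjoint:
  assumes "g \<in> carrier_mat n n" "X \<in> carrier_mat n n"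
  shows "mat_adjoint (conj_by g X) = conj_by g (mat_adjoint X)"
proof -
  have g': "mat_adjoint g \<in> carrier_mat n n" and X': "mat_adjoint X \<in> carrier_mat n n"
    using assms by auto
  have "mat_adjoint (conj_by g X) = g * (mat_adjoint X * mat_adjoint g)"
    unfolding conj_by_def
    using mat_adjoint_mult[OF mult_carrier_mat[OF assms] g'] mat_adjoint_mult[OF assms] by simp
  also have "\<dots> = conj_by g (mat_adjoint X)"
    unfolding conj_by_def using assoc_mult_mat[OF assms(1) X' g'] by simp
  finally show ?thesis .
qed

lemma conj_by_conj_by:
  assumes "g \<in> carrier_mat n n" "h \<in> carrier_mat n n" "X \<in> carrier_mat n n"
  shows "conj_by g (conj_by h X) = conj_by (g * h) X"
proof -
  have g': "mat_adjoint g \<in> carrier_mat n n" and h': "mat_adjoint h \<in> carrier_mat n n"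
    using assms by auto
  have "conj_by g (conj_by h X) = g * (h * X) * mat_adjoint h * mat_adjoint g"
    unfolding conj_by_def
    using assoc_mult_mat[OF assms(1) mult_carrier_mat[OF assms(2,3)] h'] by simp
  also have "\<dots> = g * (h * X) * (mat_adjoint h * mat_adjoint g)"
    using assms by (intro assoc_mult_mat[OF _ h' g']) auto
  also have "\<dots> = conj_by (g * h) X"
    unfolding conj_by_def using mat_adjoint_mult[OF assms(1,2)] assoc_mult_mat[OF assms] by simp
  finally show ?thesis .
qed

lemma conj_by_minus:
  assumes "g \<in> carrier_mat n n" "X \<in> carrier_mat n n" "Y \<in> carrier_mat n n"
  shows "conj_by g (X - Y) = conj_by g X - conj_by g Y"
  using assms by (simp add: conj_by_def mult_minus_distrib_mat[of _ n n] minus_mult_distrib_mat[of _ n n])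

lemma conj_by_add:
  assumes "g \<in> carrier_mat n n" "X \<in> carrier_mat n n" "Y \<in> carrier_mat n n"
  shows "conj_by g (X + Y) = conj_by g X + conj_by g Y"
  using assms by (simp add: conj_by_def mult_add_distrib_mat[of _ n n] add_mult_distrib_mat[of _ n n])

lemma conj_by_smult:
  assumes "g \<in> carrier_mat n n" "X \<in> carrier_mat n n"
  shows "conj_by g (c \<cdot>\<^sub>m X) = c \<cdot>\<^sub>m conj_by g X"
  using assms by (simp add: conj_by_def mult_smult_distrib[of _ n n] mult_smult_assoc_mat[of _ n n])

lemma conj_by_one:
  assumes "g \<in> unitary_group n"
  shows "conj_by g (1\<^sub>m n) = 1\<^sub>m n"
  using unitary_groupD[OF assms] by (simp add: conj_by_def)

section \<open>Unitary diagonalisation\<close>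

lemma scalar_prod_conjugate_self:
  fixes v :: "complex vec"
  shows "v \<bullet>c v = complex_of_real (\<Sum>l<dim_vec v. (cmod (v $ l))\<^sup>2)"
  by (simp add: scalar_prod_def atLeast0LessThan complex_norm_square del: of_real_power)

text \<open>The eigenvector is completed to an orthonormal basis, whose adjoint is the matrix sought.\<close>

lemma unitary_eigenvector_to_unit:
  fixes M :: "complex mat"
  assumes M: "M \<in> carrier_mat n n" and n: "n > 0"
  obtains U e where "U \<in> unitary_group n" "\<And>i. i < n \<Longrightarrow> conj_by U M $$ (i, 0) = (if i = 0 then e else 0)"
proof -
  obtain e where "eigenvalue M e" using spectrum_non_empty[OF M n] by (auto simp: spectrum_def)
  then obtain v where v: "v \<in> carrier_vec n" "v \<noteq> 0\<^sub>v n" "M *\<^sub>v v = e \<cdot>\<^sub>v v"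
    using M by (auto simp: eigenvalue_def eigenvector_def)
  interpret cof_vec_space n "TYPE(complex)" .
  define b where "b = basis_completion v"
  have b: "span (set b) = carrier_vec n" "distinct b" "\<not> lin_dep (set b)" "set b \<subseteq> carrier_vec n"
    "hd b = v" "length b = n"
    using basis_completion[OF v(1,2), folded b_def] by auto
  define ws where "ws = gram_schmidt n b"
  have ws: "corthogonal ws" "set ws \<subseteq> carrier_vec n" "length ws = n"
    using gram_schmidt_result[OF b(4,2,3) ws_def] b(6) by auto
  \<comment> \<open>Orthogonalisation leaves the first vector of the basis unchanged, so
    \<open>v\<close> itself survives as \<open>ws ! 0\<close>.\<close>
  have "b = v # tl b" using b(5,6) n by (cases b) auto
  then have hd: "ws ! 0 = v"
    using gram_schmidt_hd[OF v(1), of "tl b"] ws(3) n by (metis ws_def hd_conv_nth list.size(3) less_irrefl)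
  \<comment> \<open>The vectors \<open>ws\<close> are orthogonal but not normalised;
    \<open>s l\<close> is the norm of \<open>ws ! l\<close>.\<close>
  define s where "s l = sqrt (\<Sum>p<n. (cmod (ws ! l $ p))\<^sup>2)" for l
  have wsl: "ws ! l \<in> carrier_vec n" if "l < n" for l using ws that by auto
  have sq: "ws ! l \<bullet>c ws ! l = complex_of_real ((s l)\<^sup>2)" if "l < n" for l
    using wsl[OF that] by (simp add: scalar_prod_conjugate_self s_def sum_nonneg)
  have s0: "s l \<noteq> 0" if "l < n" for l
    using corthogonalD[OF ws(1), of l l] sq[OF that] ws(3) that by auto
  define U where "U = mat n n (\<lambda>(i, j). cnj (ws ! i $ j) / s i)"
  have Uc: "U \<in> carrier_mat n n" by (simp add: U_def)
  have "U * mat_adjoint U = 1\<^sub>m n"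
  proof (intro eq_matI)
    fix i j assume "i < dim_row (1\<^sub>m n :: complex mat)" "j < dim_col (1\<^sub>m n :: complex mat)"
    then have ij: "i < n" "j < n" by auto
    have "(U * mat_adjoint U) $$ (i, j) = (\<Sum>l<n. cnj (ws ! i $ l) / s i * (ws ! j $ l / s j))"
      using ij Uc by (subst mat_mult_index[of _ n n _ n]) (auto simp: U_def intro!: sum.cong)
    also have "\<dots> = (ws ! j \<bullet>c ws ! i) / (s i * s j)"
      using wsl[OF ij(1)] wsl[OF ij(2)]
      by (auto simp: scalar_prod_def atLeast0LessThan sum_divide_distrib field_simps intro!: sum.cong)
    also have "\<dots> = 1\<^sub>m n $$ (i, j)"
    proof (cases "i = j")
      case True
      then show ?thesis using sq[OF ij(1)] s0[OF ij(1)] ij by (simp add: power2_eq_square)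
    next
      case False
      then show ?thesis using corthogonalD[OF ws(1), of j i] ws(3) ij by simp
    qed
    finally show "(U * mat_adjoint U) $$ (i, j) = 1\<^sub>m n $$ (i, j)" .
  qed (use Uc in auto)
  with Uc have U: "U \<in> unitary_group n" by (rule unitary_groupI)
  have "conj_by U M $$ (i, 0) = (if i = 0 then e else 0)" if i: "i < n" for i
  proof -
    \<comment> \<open>Column 0 of \<open>mat_adjoint U\<close> is \<open>v\<close> divided by its
      norm, hence still an eigenvector. Orthonormality of the rows of \<open>U\<close> then leaves
      only the corner entry.\<close>
    have MU: "(M * mat_adjoint U) $$ (p, 0) = e * mat_adjoint U $$ (p, 0)" if "p < n" for p
    proof -
      have "(M * mat_adjoint U) $$ (p, 0) = (\<Sum>l<n. M $$ (p, l) * (v $ l / s 0))"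
        using that n M Uc hd by (subst mat_mult_index[of _ n n _ n]) (auto simp: U_def intro!: sum.cong)
      also have "\<dots> = (M *\<^sub>v v) $ p / s 0"
        using that M v(1) by (simp add: scalar_prod_def atLeast0LessThan sum_divide_distrib)
      also have "\<dots> = e * mat_adjoint U $$ (p, 0)"
        using that n Uc hd v by (simp add: U_def)
      finally show ?thesis .
    qed
    have "conj_by U M $$ (i, 0) = (U * (M * mat_adjoint U)) $$ (i, 0)"
      using assoc_mult_mat[OF Uc M, of "mat_adjoint U"] Uc by (simp add: conj_by_def)
    also have "\<dots> = (\<Sum>l<n. U $$ (i, l) * (e * mat_adjoint U $$ (l, 0)))"
      using Uc M i n MU by (subst mat_mult_index[of _ n n _ n]) auto
    also have "\<dots> = e * (\<Sum>l<n. U $$ (i, l) * mat_adjoint U $$ (l, 0))"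
      by (simp add: sum_distrib_left algebra_simps)
    also have "\<dots> = e * (U * mat_adjoint U) $$ (i, 0)"
      using Uc i n by (subst mat_mult_index[of _ n n _ n]) auto
    finally show ?thesis using unitary_groupD(2)[OF U] i n by simp
  qed
  then show ?thesis using that U by blast
qed

text \<open>Induction on the dimension: once the first basis vector is an eigenvector, a unitary
  matrix that triangularises the lower right block is extended by 1 in the corner. Column 0 stays
  zero below the diagonal.\<close>

lemma unitary_schur:
  fixes M :: "complex mat"
  assumes "M \<in> carrier_mat n n"
  shows "\<exists>U\<in>unitary_group n. upper_triangular (conj_by U M)"
  using assms
proof (induction n arbitrary: M)
  case 0
  then show ?case by (intro bexI[of _ "1\<^sub>m 0"]) (auto simp: conj_by_def)
next
  case (Suc n)
  obtain U e where U: "U \<in> unitary_group (Suc n)"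
    and col: "\<And>i. i < Suc n \<Longrightarrow> conj_by U M $$ (i, 0) = (if i = 0 then e else 0)"
    using unitary_eigenvector_to_unit[OF Suc.prems] by auto
  note Uc = unitary_groupD(1)[OF U]
  define T where "T = conj_by U M"
  have T: "T \<in> carrier_mat (Suc n) (Suc n)" using Uc Suc.prems by (simp add: T_def)
  define T' where "T' = mat n n (\<lambda>(i, j). T $$ (Suc i, Suc j))"
  obtain V where V: "V \<in> unitary_group n" and ut: "upper_triangular (conj_by V T')"
    using Suc.IH[of T'] by (auto simp: T'_def)
  note Vc = unitary_groupD(1)[OF V]
  define V' where "V' = mat (Suc n) (Suc n)
    (\<lambda>(i, j). case (i, j) of (0, 0) \<Rightarrow> 1 | (Suc i, Suc j) \<Rightarrow> V $$ (i, j) | _ \<Rightarrow> 0)"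
  have V'c: "V' \<in> carrier_mat (Suc n) (Suc n)" by (simp add: V'_def)
  have V'i: "V' $$ (0, 0) = 1" "\<And>i. i < n \<Longrightarrow> V' $$ (Suc i, 0) = 0" "\<And>i. i < n \<Longrightarrow> V' $$ (0, Suc i) = 0"
    "\<And>i j. i < n \<Longrightarrow> j < n \<Longrightarrow> V' $$ (Suc i, Suc j) = V $$ (i, j)"
    by (auto simp: V'_def)
  \<comment> \<open>Entry \<open>(Suc i, 0)\<close> of \<open>V'\<close> is zero, so row 0 of
    \<open>X\<close> drops out of all rows below the first.\<close>
  have entry: "conj_by V' X $$ (Suc i, j) =
      (\<Sum>q<Suc n. (\<Sum>p<n. V $$ (i, p) * X $$ (Suc p, q)) * cnj (V' $$ (j, q)))"
    if "X \<in> carrier_mat (Suc n) (Suc n)" "i < n" "j < Suc n" for X i j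
  proof -
    have "conj_by V' X $$ (Suc i, j) = (\<Sum>q<Suc n. (V' * X) $$ (Suc i, q) * mat_adjoint V' $$ (q, j))"
      unfolding conj_by_def using that V'c by (subst mat_mult_index[of _ "Suc n" "Suc n" _ "Suc n"]) auto
    also have "\<dots> = (\<Sum>q<Suc n. (\<Sum>p<n. V $$ (i, p) * X $$ (Suc p, q)) * cnj (V' $$ (j, q)))"
      using that V'c
      by (intro sum.cong refl arg_cong2[where f = "(*)"])
        (simp_all add: mat_mult_index[of _ "Suc n" "Suc n" _ "Suc n"] sum.lessThan_Suc_shift V'i del: index_mult_mat(1) sum.lessThan_Suc)
    finally show ?thesis .
  qed
  have entry': "conj_by V Y $$ (i, j) = (\<Sum>q<n. (\<Sum>p<n. V $$ (i, p) * Y $$ (p, q)) * cnj (V $$ (j, q)))"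
    if "Y \<in> carrier_mat n n" "i < n" "j < n" for Y i j
    unfolding conj_by_def using that Vc
    by (subst mat_mult_index[of _ n n _ n]) (auto simp: mat_mult_index[of _ n n _ n] simp del: index_mult_mat(1) intro!: sum.cong)
  have "V' * mat_adjoint V' = 1\<^sub>m (Suc n)"
  proof (intro eq_matI)
    fix i j assume "i < dim_row (1\<^sub>m (Suc n) :: complex mat)" "j < dim_col (1\<^sub>m (Suc n) :: complex mat)"
    then have ij: "i < Suc n" "j < Suc n" by auto
    have VV: "(\<Sum>l<n. V $$ (i, l) * cnj (V $$ (j, l))) = (if i = j then 1 else 0)" if "i < n" "j < n" for i j
    proof -
      have "(V * mat_adjoint V) $$ (i, j) = (\<Sum>l<n. V $$ (i, l) * cnj (V $$ (j, l)))"
        using that Vc by (subst mat_mult_index[of _ n n _ n]) auto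
      then show ?thesis using unitary_groupD(2)[OF V] that by simp
    qed
    have "(V' * mat_adjoint V') $$ (i, j) = (\<Sum>l<Suc n. V' $$ (i, l) * cnj (V' $$ (j, l)))"
      using ij V'c by (subst mat_mult_index[of _ "Suc n" "Suc n" _ "Suc n"]) auto
    also have "\<dots> = 1\<^sub>m (Suc n) $$ (i, j)"
      using ij VV by (cases i; cases j) (auto simp: sum.lessThan_Suc_shift V'i simp del: sum.lessThan_Suc)
    finally show "(V' * mat_adjoint V') $$ (i, j) = 1\<^sub>m (Suc n) $$ (i, j)" .
  qed (use V'c in auto)
  with V'c have V': "V' \<in> unitary_group (Suc n)" by (rule unitary_groupI)
  have "upper_triangular (conj_by V' T)"
  proof (rule upper_triangularI)
    fix i j assume ji: "j < i" and "i < dim_row (conj_by V' T)"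
    then obtain i' where i: "i = Suc i'" "i' < n" using V'c by (cases i) (auto simp: conj_by_def)
    have T0: "T $$ (Suc p, 0) = 0" if "p < n" for p using col[of "Suc p"] that by (simp add: T_def)
    show "conj_by V' T $$ (i, j) = 0"
    proof (cases j)
      case 0
      then show ?thesis
        using i T by (simp add: entry sum.lessThan_Suc_shift V'i T0 del: sum.lessThan_Suc)
    next
      case (Suc j')
      then have j': "j' < n" "j' < i'" using ji i by auto
      have "conj_by V' T $$ (i, j) = conj_by V T' $$ (i', j')"
        using i T j' Suc
        by (simp add: entry entry' sum.lessThan_Suc_shift V'i T0 T'_def del: sum.lessThan_Suc)
      also have "\<dots> = 0" using upper_triangularD[OF ut, of j' i'] j' i Vc by (simp add: conj_by_def)
      finally show ?thesis .
    qed
  qed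
  then have "upper_triangular (conj_by (V' * U) M)"
    using conj_by_conj_by[OF V'c Uc Suc.prems] by (simp add: T_def)
  with unitary_mult[OF V' U] show ?case by blast
qed

text \<open>The diagonal entries of the two products say that row \<open>i\<close> and column
  \<open>i\<close> of \<open>T\<close> have equal norm. Column \<open>i\<close> vanishes below the
  diagonal by triangularity and above it by the induction hypothesis for earlier rows, so only the
  diagonal entry of row \<open>i\<close> can remain.\<close>

lemma normal_upper_triangular_diagonal:
  fixes T :: "complex mat"
  assumes T: "T \<in> carrier_mat n n" and ut: "upper_triangular T"
    and normal: "T * mat_adjoint T = mat_adjoint T * T"
  shows "i < n \<Longrightarrow> j < n \<Longrightarrow> i \<noteq> j \<Longrightarrow> T $$ (i, j) = 0"
proof (induction i arbitrary: j rule: less_induct)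
  case (less i)
  let ?f = "\<lambda>p q. (cmod (T $$ (p, q)))\<^sup>2"
  have "(T * mat_adjoint T) $$ (i, i) = complex_of_real (\<Sum>l<n. ?f i l)"
    using T less.prems by (subst mat_mult_index[of _ n n _ n]) (auto simp: complex_norm_square simp del: of_real_power)
  moreover have "(mat_adjoint T * T) $$ (i, i) = complex_of_real (\<Sum>l<n. ?f l i)"
    using T less.prems by (subst mat_mult_index[of _ n n _ n]) (auto simp: complex_norm_square mult.commute simp del: of_real_power)
  ultimately have "(\<Sum>l<n. ?f i l) = (\<Sum>l<n. ?f l i)"
    using normal by (metis of_real_eq_iff)
  also have "\<dots> = (\<Sum>l\<in>{i}. ?f l i)"
  proof (rule sum.mono_neutral_right)
    show "\<forall>l\<in>{..<n} - {i}. ?f l i = 0"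
    proof
      fix l assume l: "l \<in> {..<n} - {i}"
      then show "?f l i = 0"
        using less.IH[of l i] less.prems upper_triangularD[OF ut, of i l] T by (cases "l < i") auto
    qed
  qed (use less.prems in auto)
  finally have "(\<Sum>l<n. ?f i l) = ?f i i" by simp
  moreover have "(\<Sum>l<n. ?f i l) = ?f i i + (\<Sum>l\<in>{..<n} - {i}. ?f i l)"
    using less.prems by (subst sum.remove[of _ i]) auto
  ultimately have "(\<Sum>l\<in>{..<n} - {i}. ?f i l) = 0" by simp
  then have "\<forall>l\<in>{..<n} - {i}. ?f i l = 0" by (subst (asm) sum_nonneg_eq_0_iff) auto
  then show ?case using less.prems by auto
qed

theorem normal_unitarily_diagonalisable:
  fixes M :: "complex mat"
  assumes M: "M \<in> carrier_mat n n" and normal: "M * mat_adjoint M = mat_adjoint M * M"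
  obtains U where "U \<in> unitary_group n" "diagonal_mat (conj_by U M)"
proof -
  obtain U where U: "U \<in> unitary_group n" and ut: "upper_triangular (conj_by U M)"
    using unitary_schur[OF M] by blast
  note Uc = unitary_groupD(1)[OF U]
  have "conj_by U M * mat_adjoint (conj_by U M) = mat_adjoint (conj_by U M) * conj_by U M"
    using normal M by (simp add: conj_by_adjoint[OF Uc M] flip: conj_by_mult[OF U])
  from normal_upper_triangular_diagonal[OF conj_by_carrier[OF Uc M] ut this]
  have "diagonal_mat (conj_by U M)" using Uc M by (auto simp: diagonal_mat_def conj_by_def)
  with U show ?thesis using that by blast
qed

section \<open>Trace and Frobenius norm\<close>

definition mtr :: "complex mat \<Rightarrow> complex" where
  "mtr X = (\<Sum>i<dim_row X. X $$ (i, i))"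

lemma mtr_mult_comm:
  assumes "X \<in> carrier_mat m n" "Y \<in> carrier_mat n m"
  shows "mtr (X * Y) = mtr (Y * X)"
proof -
  have "mtr (X * Y) = (\<Sum>i<m. \<Sum>j<n. X $$ (i, j) * Y $$ (j, i))"
    using assms by (simp add: mtr_def mat_mult_index[OF assms] del: index_mult_mat(1))
  also have "\<dots> = (\<Sum>j<n. \<Sum>i<m. Y $$ (j, i) * X $$ (i, j))"
    by (subst sum.swap) (simp add: mult.commute)
  also have "\<dots> = mtr (Y * X)"
    using assms by (simp add: mtr_def mat_mult_index[OF assms(2,1)] del: index_mult_mat(1))
  finally show ?thesis .
qed

lemma mtr_minus:
  assumes "X \<in> carrier_mat n n" "Y \<in> carrier_mat n n"
  shows "mtr (X - Y) = mtr X - mtr Y"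
  using assms by (simp add: mtr_def sum_subtractf)

lemma mat_comm_carrier [simp]:
  assumes "X \<in> carrier_mat n n" "Y \<in> carrier_mat n n"
  shows "mat_comm X Y \<in> carrier_mat n n"
  using assms by (auto simp: mat_comm_def)

lemma mtr_comm_mult_comm:
  assumes "A \<in> carrier_mat n n" "B \<in> carrier_mat n n" "C \<in> carrier_mat n n" "D \<in> carrier_mat n n"
  shows "mtr (mat_comm A B * mat_comm C D) =
    mtr (A * B * (C * D)) - mtr (A * B * (D * C)) - mtr (B * A * (C * D)) + mtr (B * A * (D * C))"
proof -
  note c = mult_carrier_mat[OF assms(1,2)] mult_carrier_mat[OF assms(2,1)]
    mult_carrier_mat[OF assms(3,4)] mult_carrier_mat[OF assms(4,3)]
  have "mat_comm A B * mat_comm C D =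
      (A * B * (C * D) - A * B * (D * C)) - (B * A * (C * D) - B * A * (D * C))"
    unfolding mat_comm_def
    by (simp only: minus_mult_distrib_mat[OF c(1,2) minus_carrier_mat[OF c(4)]]
        mult_minus_distrib_mat[OF c(1) c(3,4)] mult_minus_distrib_mat[OF c(2) c(3,4)])
  then show ?thesis
    using c by (simp add: mtr_minus[of _ n] minus_carrier_mat)
qed

text \<open>Cyclicity of the trace, in the pairwise bracketing that products of two commutators
  produce.\<close>

lemma mtr_rotate:
  assumes "A \<in> carrier_mat n n" "B \<in> carrier_mat n n" "C \<in> carrier_mat n n" "D \<in> carrier_mat n n"
  shows "mtr (A * B * (C * D)) = mtr (B * C * (D * A))"
proof -
  note CD = mult_carrier_mat[OF assms(3,4)] and BC = mult_carrier_mat[OF assms(2,3)]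
  have "mtr (A * B * (C * D)) = mtr (A * (B * (C * D)))"
    using assoc_mult_mat[OF assms(1,2) CD] by simp
  also have "\<dots> = mtr (B * (C * D) * A)"
    by (rule mtr_mult_comm[OF assms(1) mult_carrier_mat[OF assms(2) CD]])
  also have "B * (C * D) * A = B * C * (D * A)"
    using assoc_mult_mat[OF assms(2,3,4)] assoc_mult_mat[OF BC assms(4,1)] by simp
  finally show ?thesis .
qed

text \<open>Since tr([A,B] Z) = tr(A [B,Z]), the sum is the trace of A times [B,[C,D]] + [C,[D,B]] +
  [D,[B,C]]. In the proof the twelve expanded traces cancel in pairs under cyclic shifts.\<close>

lemma mtr_comm_jacobi:
  assumes "A \<in> carrier_mat n n" "B \<in> carrier_mat n n" "C \<in> carrier_mat n n" "D \<in> carrier_mat n n"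
  shows "mtr (mat_comm A B * mat_comm C D) - mtr (mat_comm A C * mat_comm B D)
    + mtr (mat_comm A D * mat_comm B C) = 0"
  using mtr_rotate[OF assms(2,1,3,4)] mtr_rotate[OF assms(2,1,4,3)] mtr_rotate[OF assms(3,1,2,4)]
    mtr_rotate[OF assms(3,1,4,2)] mtr_rotate[OF assms(4,1,2,3)] mtr_rotate[OF assms(4,1,3,2)]
  by (simp add: mtr_comm_mult_comm[OF assms] mtr_comm_mult_comm[OF assms(1,3,2,4)]
      mtr_comm_mult_comm[OF assms(1,4,2,3)])

definition fro2 :: "complex mat \<Rightarrow> real" where
  "fro2 X = (\<Sum>i<dim_row X. \<Sum>j<dim_col X. (cmod (X $$ (i, j)))\<^sup>2)"

lemma fro2_nonneg: "fro2 X \<ge> 0"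
  by (auto simp: fro2_def intro!: sum_nonneg)

lemma fro2_eq_0:
  assumes "fro2 X = 0" "X \<in> carrier_mat m n"
  shows "X = 0\<^sub>m m n"
proof (intro eq_matI)
  fix i j assume ij: "i < dim_row (0\<^sub>m m n :: complex mat)" "j < dim_col (0\<^sub>m m n :: complex mat)"
  have "\<forall>i<m. (\<Sum>j<n. (cmod (X $$ (i, j)))\<^sup>2) = 0"
    using assms by (subst (asm) fro2_def, subst (asm) sum_nonneg_eq_0_iff) (auto intro: sum_nonneg)
  with ij have "(\<Sum>j<n. (cmod (X $$ (i, j)))\<^sup>2) = 0" by auto
  with ij show "X $$ (i, j) = 0\<^sub>m m n $$ (i, j)"
    by (subst (asm) sum_nonneg_eq_0_iff) auto
qed (use assms in auto)

lemma fro2_mtr: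
  assumes "X \<in> carrier_mat m n"
  shows "complex_of_real (fro2 X) = mtr (mat_adjoint X * X)"
proof -
  have "mtr (mat_adjoint X * X) = (\<Sum>j<n. \<Sum>i<m. cnj (X $$ (i, j)) * X $$ (i, j))"
    using assms by (simp add: mtr_def mat_mult_index[of _ n m _ n] del: index_mult_mat(1))
  also have "\<dots> = (\<Sum>i<m. \<Sum>j<n. X $$ (i, j) * cnj (X $$ (i, j)))"
    by (subst sum.swap) (simp add: mult.commute)
  also have "\<dots> = complex_of_real (fro2 X)"
    using assms by (simp add: fro2_def complex_norm_square del: of_real_power)
  finally show ?thesis ..
qed

lemma fro2_adjoint [simp]: "fro2 (mat_adjoint X) = fro2 X"
  unfolding fro2_def by (subst sum.swap) simp

lemma fro2_unitary_mult:
  assumes g: "g \<in> unitary_group m" and X: "X \<in> carrier_mat m n"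
  shows "fro2 (g * X) = fro2 X"
proof -
  note gc = unitary_groupD(1)[OF g]
  have X': "mat_adjoint X \<in> carrier_mat n m" and g': "mat_adjoint g \<in> carrier_mat m m"
    using X gc by auto
  have "mat_adjoint (g * X) * (g * X) = mat_adjoint X * (mat_adjoint g * (g * X))"
    using assoc_mult_mat[OF X' g' mult_carrier_mat[OF gc X]] by (simp add: mat_adjoint_mult[OF gc X])
  also have "\<dots> = mat_adjoint X * X"
    by (simp add: unitary_cancel(1)[OF g X gc])
  finally have "complex_of_real (fro2 (g * X)) = complex_of_real (fro2 X)"
    by (simp add: fro2_mtr[OF X] fro2_mtr[OF mult_carrier_mat[OF gc X]])
  then show ?thesis by simp
qed

text \<open>The norm does not change under adjoints, so the factor on the right is handled as a
  second factor on the left.\<close>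

lemma fro2_conj_by:
  assumes g: "g \<in> unitary_group n" and X: "X \<in> carrier_mat n n"
  shows "fro2 (conj_by g X) = fro2 X"
proof -
  note gc = unitary_groupD(1)[OF g]
  have gX: "g * X \<in> carrier_mat n n" and g': "mat_adjoint g \<in> carrier_mat n n"
    and gX': "mat_adjoint (g * X) \<in> carrier_mat n n"
    using X gc by auto
  have "mat_adjoint (conj_by g X) = g * mat_adjoint (g * X)"
    unfolding conj_by_def by (simp add: mat_adjoint_mult[OF gX g'])
  then have "fro2 (conj_by g X) = fro2 (g * mat_adjoint (g * X))"
    by (metis fro2_adjoint)
  also have "\<dots> = fro2 X"
    using fro2_unitary_mult[OF g gX'] fro2_unitary_mult[OF g X] by simp
  finally show ?thesis .
qed

section \<open>Solutions of the ADHM equations commute\<close>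

lemma atLeastAtMost_1_4: "{1..4::nat} = {1, 2, 3, 4}"
  by auto

text \<open>The adjoint reverses products, whence the sign.\<close>

lemma mat_comm_adjoint_index:
  assumes "X \<in> carrier_mat n n" "Y \<in> carrier_mat n n" "i < n" "j < n"
  shows "mat_comm (mat_adjoint X) (mat_adjoint Y) $$ (i, j) = - cnj (mat_comm X Y $$ (j, i))"
proof -
  have "mat_comm (mat_adjoint X) (mat_adjoint Y) = mat_adjoint (Y * X) - mat_adjoint (X * Y)"
    by (simp add: mat_comm_def mat_adjoint_mult[OF assms(1,2)] mat_adjoint_mult[OF assms(2,1)])
  with assms show ?thesis
    by (simp add: mat_comm_def del: index_mult_mat(1))
qed

lemma fro2_skew_adjoint_mtr:
  assumes "X \<in> carrier_mat n n" "Y \<in> carrier_mat n n"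
    and "\<And>i j. i < n \<Longrightarrow> j < n \<Longrightarrow> X $$ (i, j) = of_int s * cnj (Y $$ (j, i))"
  shows "complex_of_real (fro2 X) = of_int s * mtr (X * Y)"
proof -
  have "complex_of_real (fro2 X) = (\<Sum>i<n. \<Sum>j<n. X $$ (i, j) * cnj (X $$ (i, j)))"
    using assms by (simp add: fro2_def complex_norm_square del: of_real_power)
  also have "\<dots> = (\<Sum>i<n. \<Sum>j<n. X $$ (i, j) * (of_int s * Y $$ (j, i)))"
    using assms(3) by (intro sum.cong refl arg_cong2[where f = "(*)"]) auto
  also have "\<dots> = of_int s * mtr (X * Y)"
    using assms by (simp add: mtr_def mat_mult_index[OF assms(1,2)] sum_distrib_left algebra_simps
        del: index_mult_mat(1))
  finally show ?thesis .
qed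

lemma fro2_zero_skew_adjoint:
  assumes "X \<in> carrier_mat n n" "Y \<in> carrier_mat n n" "s \<noteq> 0" "fro2 X = 0"
    and "\<And>i j. i < n \<Longrightarrow> j < n \<Longrightarrow> X $$ (i, j) = of_int s * cnj (Y $$ (j, i))"
  shows "X = 0\<^sub>m n n" "Y = 0\<^sub>m n n"
proof -
  show X: "X = 0\<^sub>m n n" using assms fro2_eq_0 by blast
  show "Y = 0\<^sub>m n n"
  proof (intro eq_matI)
    fix i j assume "i < dim_row (0\<^sub>m n n :: complex mat)" "j < dim_col (0\<^sub>m n n :: complex mat)"
    then show "Y $$ (i, j) = 0\<^sub>m n n $$ (i, j)"
      using assms(5)[of j i] X assms(3) by auto
  qed (use assms in auto)
qed

lemma adhm_solutions_commute:
  assumes sol: "(B, I) \<in> adhm_solutions A r k \<zeta>" and ab: "a \<in> {1..4}" "b \<in> {1..4}"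
  shows "B a * B b = B b * B a"
proof -
  have Bc: "B a \<in> carrier_mat k k" if "a \<in> {1..4}" for a
    using sol that by (auto simp: adhm_solutions_def adhm_space_def)
  define C where "C a b = mat_comm (B a) (B b)" for a b
  have Cc: "C a b \<in> carrier_mat k k" if "a \<in> {1..4}" "b \<in> {1..4}" for a b
    using Bc that by (simp add: C_def)
  have eq: "C a b $$ (i, j) =
      - 1/2 * (\<Sum>c\<in>{1..4}. \<Sum>d\<in>{1..4}. of_int (levi_civita a b c d) * cnj (C c d $$ (j, i)))"
    if "1 \<le> a" "a < b" "b \<le> 4" "i < k" "j < k" for a b i j
  proof -
    let ?S = "mat_sum k (\<lambda>(c, d). of_int (levi_civita a b c d) \<cdot>\<^sub>m
                      mat_comm (mat_adjoint (B c)) (mat_adjoint (B d))) ({1..4} \<times> {1..4})"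
    have "C a b - (1/2) \<cdot>\<^sub>m ?S = 0\<^sub>m k k"
      using sol that by (auto simp: adhm_solutions_def C_def)
    then have "(C a b - (1/2) \<cdot>\<^sub>m ?S) $$ (i, j) = 0" using that by simp
    then have "C a b $$ (i, j) = 1/2 * ?S $$ (i, j)"
      using that by (simp add: mat_sum_def)
    also have "?S $$ (i, j) = (\<Sum>(c, d)\<in>{1..4} \<times> {1..4}.
        - (of_int (levi_civita a b c d) * cnj (C c d $$ (j, i))))"
      unfolding mat_sum_def using that
    proof (simp add: mat_sum_def, intro sum.cong refl)
      fix p assume p: "p \<in> {Suc 0..4} \<times> {Suc 0..4::nat}"
      obtain c d where cd: "p = (c, d)" by force
      with p have cd': "c \<in> {1..4}" "d \<in> {1..4}" by auto
      have "mat_comm (mat_adjoint (B c)) (mat_adjoint (B d)) \<in> carrier_mat k k"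
        using Bc[OF cd'(1)] Bc[OF cd'(2)] by simp
      then show "(case p of (c, d) \<Rightarrow> of_int (levi_civita a b c d) \<cdot>\<^sub>m
              mat_comm (mat_adjoint (B c)) (mat_adjoint (B d))) $$ (i, j) =
          (case p of (c, d) \<Rightarrow> - (of_int (levi_civita a b c d) * cnj (C c d $$ (j, i))))"
        using mat_comm_adjoint_index[OF Bc[OF cd'(1)] Bc[OF cd'(2)] that(4,5)] that(4,5)
        by (simp add: cd C_def)
    qed
    finally show ?thesis
      by (simp add: sum.cartesian_product[symmetric] sum_negf)
  qed
  have anti: "C c d $$ (i, j) = - C d c $$ (i, j)" if "c \<in> {1..4}" "d \<in> {1..4}" "i < k" "j < k" for c d i j
    using Bc[OF that(1)] Bc[OF that(2)] that(3,4) by (simp add: C_def mat_comm_def del: index_mult_mat(1))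
  \<comment> \<open>Only the complementary pair contributes, in its two orders; these agree by
    antisymmetry and absorb the factor 1/2.\<close>
  have e: "C 1 2 $$ (i, j) = of_int (- 1) * cnj (C 3 4 $$ (j, i))"
    "C 1 3 $$ (i, j) = of_int 1 * cnj (C 2 4 $$ (j, i))"
    "C 1 4 $$ (i, j) = of_int (- 1) * cnj (C 2 3 $$ (j, i))" if "i < k" "j < k" for i j
    using eq[of 1 2 i j] eq[of 1 3 i j] eq[of 1 4 i j] that
      anti[of 4 3 j i] anti[of 4 2 j i] anti[of 3 2 j i]
    unfolding atLeastAtMost_1_4 by (simp_all add: levi_civita_def)
  have c: "C 1 2 \<in> carrier_mat k k" "C 1 3 \<in> carrier_mat k k" "C 1 4 \<in> carrier_mat k k"
    "C 2 3 \<in> carrier_mat k k" "C 2 4 \<in> carrier_mat k k" "C 3 4 \<in> carrier_mat k k"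
    by (auto intro!: Cc)
  \<comment> \<open>The signs -1, 1, -1 of the three relations are, up to a common factor, those of
    the Jacobi identity.\<close>
  have "complex_of_real (fro2 (C 1 2) + fro2 (C 1 3) + fro2 (C 1 4)) =
      - (mtr (C 1 2 * C 3 4) - mtr (C 1 3 * C 2 4) + mtr (C 1 4 * C 2 3))"
    using fro2_skew_adjoint_mtr[OF c(1,6) e(1)] fro2_skew_adjoint_mtr[OF c(2,5) e(2)]
      fro2_skew_adjoint_mtr[OF c(3,4) e(3)] by simp
  also have "\<dots> = 0"
    unfolding C_def using mtr_comm_jacobi[OF Bc[of 1] Bc[of 2] Bc[of 3] Bc[of 4]] by simp
  finally have "fro2 (C 1 2) + fro2 (C 1 3) + fro2 (C 1 4) = 0"
    by (simp only: of_real_eq_0_iff)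
  then have f: "fro2 (C 1 2) = 0" "fro2 (C 1 3) = 0" "fro2 (C 1 4) = 0"
    using fro2_nonneg[of "C 1 2"] fro2_nonneg[of "C 1 3"] fro2_nonneg[of "C 1 4"] by linarith+
  have z: "C 1 2 = 0\<^sub>m k k" "C 3 4 = 0\<^sub>m k k" "C 1 3 = 0\<^sub>m k k" "C 2 4 = 0\<^sub>m k k"
    "C 1 4 = 0\<^sub>m k k" "C 2 3 = 0\<^sub>m k k"
    using fro2_zero_skew_adjoint[OF c(1,6) _ f(1) e(1)] fro2_zero_skew_adjoint[OF c(2,5) _ f(2) e(2)]
      fro2_zero_skew_adjoint[OF c(3,4) _ f(3) e(3)] by simp_all
  have comm: "B a * B b = B b * B a" if "C a b = 0\<^sub>m k k" "a \<in> {1..4}" "b \<in> {1..4}" for a b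
  proof (intro eq_matI)
    fix i j assume "i < dim_row (B b * B a)" "j < dim_col (B b * B a)"
    then have ij: "i < k" "j < k" using Bc that by auto
    then have "C a b $$ (i, j) = 0" using that(1) by simp
    then show "(B a * B b) $$ (i, j) = (B b * B a) $$ (i, j)"
      using ij Bc[OF that(2)] Bc[OF that(3)] by (simp add: C_def mat_comm_def del: index_mult_mat(1))
  qed (use Bc[OF that(2)] Bc[OF that(3)] in auto)
  note cs = z[THEN comm, simplified]
  from ab have "a \<in> {1, 2, 3, 4}" "b \<in> {1, 2, 3, 4}" by auto
  then show ?thesis by (elim insertE emptyE) (simp_all add: cs)
qed

section \<open>Gauge invariance\<close>

text \<open>Commutativity is equivalent to the six commutator equations, as commuting matrices have
  commuting adjoints, and its gauge invariance is immediate.\<close>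

definition commuting_adhm :: "nat \<Rightarrow> nat \<Rightarrow> nat \<Rightarrow> real \<Rightarrow> adhm set" where
  "commuting_adhm c r k \<zeta> = {(B, I). (B, I) \<in> adhm_space k r \<and>
     (\<forall>a\<in>{1..4}. \<forall>b\<in>{1..4}. B a * B b = B b * B a) \<and>
     mat_sum k (\<lambda>a. mat_comm (B a) (mat_adjoint (B a))) {1..4} + I * mat_adjoint I
       = complex_of_real \<zeta> \<cdot>\<^sub>m 1\<^sub>m k \<and>
     B c * I = 0\<^sub>m k r}"

lemma adhm_solutions_commuting:
  "x \<in> adhm_solutions A r k \<zeta> \<Longrightarrow> x \<in> commuting_adhm (missing_index A) r k \<zeta>"
  using adhm_solutions_commute[of "fst x" "snd x" A r k \<zeta>]
  by (auto simp: commuting_adhm_def adhm_solutions_def)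

lemma gauge_act_conj_by: "gauge_act g (B, I) = (\<lambda>a\<in>{1..4}. conj_by g (B a), g * I)"
  by (simp add: gauge_act_def conj_by_def)

lemma gauge_act_adhm_space:
  assumes "g \<in> carrier_mat k k" "x \<in> adhm_space k r"
  shows "gauge_act g x \<in> adhm_space k r"
  using assms by (cases x) (auto simp: adhm_space_def gauge_act_conj_by PiE_iff)

lemma conj_by_index:
  assumes "g \<in> carrier_mat n n" "X \<in> carrier_mat n n" "i < n" "j < n"
  shows "conj_by g X $$ (i, j) = (\<Sum>q<n. \<Sum>p<n. g $$ (i, p) * X $$ (p, q) * cnj (g $$ (j, q)))"
  unfolding conj_by_def using assms
  by (subst mat_mult_index[of _ n n _ n])
    (auto simp: mat_mult_index[of _ n n _ n] sum_distrib_right simp del: index_mult_mat(1) intro!: sum.cong)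

lemma mat_sum_cong: "(\<And>s. s \<in> S \<Longrightarrow> f s = f' s) \<Longrightarrow> mat_sum k f S = mat_sum k f' S"
  unfolding mat_sum_def by (intro cong_mat refl) (auto intro!: sum.cong)

text \<open>As \<open>mat_sum\<close> is given by its entries, linearity of conjugation amounts to
  an exchange of finite sums.\<close>

lemma mat_sum_conj_by:
  assumes g: "g \<in> carrier_mat k k" and f: "\<And>s. s \<in> S \<Longrightarrow> f s \<in> carrier_mat k k"
  shows "mat_sum k (\<lambda>s. conj_by g (f s)) S = conj_by g (mat_sum k f S)"
proof (intro eq_matI)
  have c: "mat_sum k f S \<in> carrier_mat k k" for f by (simp add: mat_sum_def)
  fix i j assume "i < dim_row (conj_by g (mat_sum k f S))" "j < dim_col (conj_by g (mat_sum k f S))"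
  then have ij: "i < k" "j < k" using g by (auto simp: conj_by_def)
  have "mat_sum k (\<lambda>s. conj_by g (f s)) S $$ (i, j) =
      (\<Sum>s\<in>S. \<Sum>q<k. \<Sum>p<k. g $$ (i, p) * f s $$ (p, q) * cnj (g $$ (j, q)))"
    using ij f by (simp add: mat_sum_def conj_by_index[OF g])
  also have "\<dots> = (\<Sum>q<k. \<Sum>p<k. \<Sum>s\<in>S. g $$ (i, p) * f s $$ (p, q) * cnj (g $$ (j, q)))"
    by (subst sum.swap, intro sum.cong refl sum.swap)
  also have "\<dots> = conj_by g (mat_sum k f S) $$ (i, j)"
    using ij by (subst conj_by_index[OF g c]) (simp_all add: mat_sum_def sum_distrib_left sum_distrib_right)
  finally show "mat_sum k (\<lambda>s. conj_by g (f s)) S $$ (i, j) = conj_by g (mat_sum k f S) $$ (i, j)" .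
qed (use g in \<open>auto simp: mat_sum_def conj_by_def\<close>)

text \<open>The moment map is equivariant and a scalar matrix is fixed by conjugation. This allows a
  passage to adapted bases; the full matrix equation is needed for it, although later only diagonal
  entries in the new basis are read off.\<close>

lemma gauge_act_commuting_adhm:
  assumes g: "g \<in> unitary_group k" and c: "c \<in> {1..4}" and x: "x \<in> commuting_adhm c r k \<zeta>"
  shows "gauge_act g x \<in> commuting_adhm c r k \<zeta>"
proof -
  obtain B I where x_def: "x = (B, I)" by force
  note gc = unitary_groupD(1)[OF g]
  have sp: "(B, I) \<in> adhm_space k r"
    and comm: "\<And>a b. a \<in> {1..4} \<Longrightarrow> b \<in> {1..4} \<Longrightarrow> B a * B b = B b * B a"
    and mom: "mat_sum k (\<lambda>a. mat_comm (B a) (mat_adjoint (B a))) {1..4} + I * mat_adjoint I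
       = complex_of_real \<zeta> \<cdot>\<^sub>m 1\<^sub>m k"
    and BI: "B c * I = 0\<^sub>m k r"
    using x by (auto simp: commuting_adhm_def x_def)
  have Bc: "B a \<in> carrier_mat k k" if "a \<in> {1..4}" for a using sp that by (auto simp: adhm_space_def)
  have Ic: "I \<in> carrier_mat k r" using sp by (auto simp: adhm_space_def)
  have Bc': "mat_adjoint (B a) \<in> carrier_mat k k" if "a \<in> {1..4}" for a using Bc[OF that] by simp
  have Ic': "mat_adjoint I \<in> carrier_mat r k" and gc': "mat_adjoint g \<in> carrier_mat k k"
    using Ic gc by auto
  let ?B = "\<lambda>a\<in>{1..4}. conj_by g (B a)"
  have "mat_comm (?B a) (mat_adjoint (?B a)) = conj_by g (mat_comm (B a) (mat_adjoint (B a)))"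
    if "a \<in> {1..4}" for a
    using that Bc[OF that] Bc'[OF that]
    by (simp add: mat_comm_def conj_by_adjoint[OF gc] conj_by_mult[OF g]
        conj_by_minus[OF gc mult_carrier_mat[OF Bc Bc'] mult_carrier_mat[OF Bc' Bc]])
  then have "mat_sum k (\<lambda>a. mat_comm (?B a) (mat_adjoint (?B a))) {1..4}
      = mat_sum k (\<lambda>a. conj_by g (mat_comm (B a) (mat_adjoint (B a)))) {1..4}"
    by (rule mat_sum_cong)
  also have "\<dots> = conj_by g (mat_sum k (\<lambda>a. mat_comm (B a) (mat_adjoint (B a))) {1..4})"
    using Bc Bc' by (intro mat_sum_conj_by[OF gc]) simp
  finally have 1: "mat_sum k (\<lambda>a. mat_comm (?B a) (mat_adjoint (?B a))) {1..4}
      = conj_by g (mat_sum k (\<lambda>a. mat_comm (B a) (mat_adjoint (B a))) {1..4})" .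
  have 2: "g * I * mat_adjoint (g * I) = conj_by g (I * mat_adjoint I)"
  proof -
    have "g * I * mat_adjoint (g * I) = g * I * (mat_adjoint I * mat_adjoint g)"
      by (simp add: mat_adjoint_mult[OF gc Ic])
    also have "\<dots> = g * I * mat_adjoint I * mat_adjoint g"
      by (rule assoc_mult_mat[OF mult_carrier_mat[OF gc Ic] Ic' gc', symmetric])
    also have "g * I * mat_adjoint I = g * (I * mat_adjoint I)"
      by (rule assoc_mult_mat[OF gc Ic Ic'])
    finally show ?thesis by (simp add: conj_by_def)
  qed
  have "mat_sum k (\<lambda>a. mat_comm (?B a) (mat_adjoint (?B a))) {1..4} + g * I * mat_adjoint (g * I)
      = conj_by g (complex_of_real \<zeta> \<cdot>\<^sub>m 1\<^sub>m k)"
    unfolding 1 2 mom[symmetric] using Ic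
    by (intro conj_by_add[OF gc, symmetric]) (auto simp: mat_sum_def)
  also have "\<dots> = complex_of_real \<zeta> \<cdot>\<^sub>m 1\<^sub>m k"
    by (simp add: conj_by_smult[OF gc] conj_by_one[OF g])
  finally have mom': "mat_sum k (\<lambda>a. mat_comm (?B a) (mat_adjoint (?B a))) {1..4} + g * I * mat_adjoint (g * I)
      = complex_of_real \<zeta> \<cdot>\<^sub>m 1\<^sub>m k" .
  have "conj_by g (B c) * (g * I) = g * B c * (mat_adjoint g * (g * I))"
    unfolding conj_by_def
    by (rule assoc_mult_mat[OF mult_carrier_mat[OF gc Bc[OF c]] gc' mult_carrier_mat[OF gc Ic]])
  also have "\<dots> = g * (B c * I)"
    using assoc_mult_mat[OF gc Bc[OF c] Ic] by (simp add: unitary_cancel(1)[OF g Ic gc])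
  also have "\<dots> = 0\<^sub>m k r" using gc by (simp add: BI)
  finally have BI': "?B c * (g * I) = 0\<^sub>m k r" using c by simp
  have comm': "?B a * ?B b = ?B b * ?B a" if "a \<in> {1..4}" "b \<in> {1..4}" for a b
    using that comm[OF that] by (simp add: conj_by_mult[OF g Bc Bc, symmetric])
  show ?thesis
    using gauge_act_adhm_space[OF gc, of x r] sp comm' mom' BI'
    by (simp add: x_def commuting_adhm_def gauge_act_conj_by)
qed

section \<open>Boundedness of the fixed locus\<close>

lemma sum_weighted_moment:
  fixes b :: "'a \<Rightarrow> nat \<Rightarrow> nat \<Rightarrow> real"
  shows "(\<Sum>i<k. n i * (\<Sum>a\<in>S. (\<Sum>j<k. b a i j) - (\<Sum>j<k. b a j i))) =
    (\<Sum>a\<in>S. \<Sum>i<k. \<Sum>j<k. (n i - n j) * b a i j)"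
proof -
  have "(\<Sum>i<k. n i * (\<Sum>a\<in>S. (\<Sum>j<k. b a i j) - (\<Sum>j<k. b a j i)))
      = (\<Sum>a\<in>S. \<Sum>i<k. n i * ((\<Sum>j<k. b a i j) - (\<Sum>j<k. b a j i)))"
    by (simp add: sum_distrib_left) (rule sum.swap)
  also have "\<dots> = (\<Sum>a\<in>S. (\<Sum>i<k. \<Sum>j<k. n i * b a i j) - (\<Sum>i<k. \<Sum>j<k. n i * b a j i))"
    by (simp add: right_diff_distrib sum_subtractf sum_distrib_left)
  also have "\<dots> = (\<Sum>a\<in>S. (\<Sum>i<k. \<Sum>j<k. n i * b a i j) - (\<Sum>i<k. \<Sum>j<k. n j * b a i j))"
    by (subst (2) sum.swap) (rule refl)
  also have "\<dots> = (\<Sum>a\<in>S. \<Sum>i<k. \<Sum>j<k. (n i - n j) * b a i j)"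
    by (simp add: left_diff_distrib sum_subtractf)
  finally show ?thesis .
qed

text \<open>Stability, for subspaces spanned by basis vectors: here \<open>b a i j\<close> stands for
  \<open>\<bar>B a $$ (i, j)\<bar>\<^sup>2\<close> and \<open>w i\<close> for the squared norm of the \<open>i\<close>-th row of \<open>I\<close>. The trace of
  the moment map equation over the complement has a nonpositive left-hand side.\<close>

lemma invariant_index_set_full:
  fixes b :: "'a \<Rightarrow> nat \<Rightarrow> nat \<Rightarrow> real"
  assumes moment: "\<And>i. i < k \<Longrightarrow> (\<Sum>a\<in>S. (\<Sum>j<k. b a i j) - (\<Sum>j<k. b a j i)) + w i = \<zeta>"
    and nonneg: "\<And>a i j. b a i j \<ge> 0" and \<zeta>: "\<zeta> > 0"
    and b0: "\<And>a i j. a \<in> S \<Longrightarrow> i < k \<Longrightarrow> j < k \<Longrightarrow> i \<notin> J \<Longrightarrow> j \<in> J \<Longrightarrow> b a i j = 0"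
    and w0: "\<And>i. i < k \<Longrightarrow> i \<notin> J \<Longrightarrow> w i = 0"
  shows "{..<k} \<subseteq> J"
proof -
  \<comment> \<open>The weight is the indicator function of the complement of
    \<open>J\<close>.\<close>
  define n :: "nat \<Rightarrow> real" where "n i = (if i \<in> J then 0 else 1)" for i
  have "\<zeta> * (\<Sum>i<k. n i) = (\<Sum>i<k. n i * ((\<Sum>a\<in>S. (\<Sum>j<k. b a i j) - (\<Sum>j<k. b a j i)) + w i))"
    using moment by (simp add: sum_distrib_left mult.commute)
  also have "\<dots> = (\<Sum>i<k. n i * (\<Sum>a\<in>S. (\<Sum>j<k. b a i j) - (\<Sum>j<k. b a j i)))"
    using w0 by (intro sum.cong) (auto simp: n_def)
  also have "\<dots> = (\<Sum>a\<in>S. \<Sum>i<k. \<Sum>j<k. (n i - n j) * b a i j)"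
    by (rule sum_weighted_moment)
  \<comment> \<open>The factor \<open>n i - n j\<close> is positive only for \<open>i\<close>
    outside and \<open>j\<close> inside \<open>J\<close>, and there \<open>b a i j\<close> vanishes
    by invariance.\<close>
  also have "\<dots> \<le> 0"
    using b0 nonneg by (intro sum_nonpos) (auto simp: n_def)
  finally have "(\<Sum>i<k. n i) \<le> 0" using \<zeta> by (simp add: mult_le_0_iff)
  moreover have "(\<Sum>i<k. n i) \<ge> 0" by (intro sum_nonneg) (auto simp: n_def)
  ultimately have "(\<Sum>i<k. n i) = 0" by linarith
  then have "\<forall>i<k. n i = 0" by (subst (asm) sum_nonneg_eq_0_iff) (auto simp: n_def)
  then show ?thesis by (auto simp: n_def split: if_splits)
qed

text \<open>The diagonal entries of B B^* and B^* B are the squared norms of the rows and of the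
  columns of B.\<close>

lemma commuting_adhm_moment:
  assumes x: "(B, I) \<in> commuting_adhm c r k \<zeta>" and i: "i < k"
  shows "(\<Sum>a\<in>{1..4}. (\<Sum>j<k. (cmod (B a $$ (i, j)))\<^sup>2) - (\<Sum>j<k. (cmod (B a $$ (j, i)))\<^sup>2))
    + (\<Sum>l<r. (cmod (I $$ (i, l)))\<^sup>2) = \<zeta>"
proof -
  have sp: "(B, I) \<in> adhm_space k r"
    and mom: "mat_sum k (\<lambda>a. mat_comm (B a) (mat_adjoint (B a))) {1..4} + I * mat_adjoint I
       = complex_of_real \<zeta> \<cdot>\<^sub>m 1\<^sub>m k"
    using x by (auto simp: commuting_adhm_def)
  have Bc: "B a \<in> carrier_mat k k" if "a \<in> {1..4}" for a using sp that by (auto simp: adhm_space_def)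
  have Ic: "I \<in> carrier_mat k r" using sp by (auto simp: adhm_space_def)
  have comm: "mat_comm (B a) (mat_adjoint (B a)) $$ (i, i) =
      complex_of_real ((\<Sum>j<k. (cmod (B a $$ (i, j)))\<^sup>2) - (\<Sum>j<k. (cmod (B a $$ (j, i)))\<^sup>2))"
    if a: "a \<in> {1..4}" for a
  proof -
    have B': "mat_adjoint (B a) \<in> carrier_mat k k" using Bc[OF a] by simp
    show ?thesis
      using i Bc[OF a] by (simp add: mat_comm_def mat_mult_index[OF Bc[OF a] B'] mat_mult_index[OF B' Bc[OF a]]
          complex_norm_square mult.commute del: index_mult_mat(1) of_real_power)
  qed
  have II: "(I * mat_adjoint I) $$ (i, i) = complex_of_real (\<Sum>l<r. (cmod (I $$ (i, l)))\<^sup>2)"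
    using i Ic by (subst mat_mult_index[of _ k r _ k]) (auto simp: complex_norm_square simp del: of_real_power)
  have "(mat_sum k (\<lambda>a. mat_comm (B a) (mat_adjoint (B a))) {1..4} + I * mat_adjoint I) $$ (i, i)
      = mat_sum k (\<lambda>a. mat_comm (B a) (mat_adjoint (B a))) {1..4} $$ (i, i) + (I * mat_adjoint I) $$ (i, i)"
    using i Ic by (intro index_add_mat) auto
  also have "\<dots> = complex_of_real ((\<Sum>a\<in>{1..4}. (\<Sum>j<k. (cmod (B a $$ (i, j)))\<^sup>2)
      - (\<Sum>j<k. (cmod (B a $$ (j, i)))\<^sup>2)) + (\<Sum>l<r. (cmod (I $$ (i, l)))\<^sup>2))"
    using i comm unfolding II by (simp add: mat_sum_def del: of_real_diff of_real_power)
  finally have "complex_of_real ((\<Sum>a\<in>{1..4}. (\<Sum>j<k. (cmod (B a $$ (i, j)))\<^sup>2)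
      - (\<Sum>j<k. (cmod (B a $$ (j, i)))\<^sup>2)) + (\<Sum>l<r. (cmod (I $$ (i, l)))\<^sup>2)) = complex_of_real \<zeta>"
    unfolding mom using i by simp
  then show ?thesis by (simp only: of_real_eq_iff)
qed

text \<open>The kernel of \<open>B c\<close> contains the image of \<open>I\<close> and is preserved by all \<open>B a\<close>. It is
  spanned by basis vectors once \<open>(B c)\<^sup>\<dagger> B c\<close> is diagonal.\<close>

lemma commuting_adhm_missing_zero:
  assumes x: "(B, I) \<in> commuting_adhm c r k \<zeta>" and c: "c \<in> {1..4}" and \<zeta>: "\<zeta> > 0"
  shows "B c = 0\<^sub>m k k"
proof -
  have Dc: "B c \<in> carrier_mat k k" using x c by (auto simp: commuting_adhm_def adhm_space_def)
  define H where "H = mat_adjoint (B c) * B c"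
  have D': "mat_adjoint (B c) \<in> carrier_mat k k" using Dc by simp
  have H: "H \<in> carrier_mat k k" using Dc D' by (simp add: H_def)
  have "mat_adjoint H = H" unfolding H_def by (simp add: mat_adjoint_mult[OF D' Dc])
  then obtain U where U: "U \<in> unitary_group k" and diag: "diagonal_mat (conj_by U H)"
    using normal_unitarily_diagonalisable[OF H] by metis
  note Uc = unitary_groupD(1)[OF U]
  define B' where "B' = (\<lambda>a\<in>{1..4}. conj_by U (B a))"
  define I' where "I' = U * I"
  have x': "(B', I') \<in> commuting_adhm c r k \<zeta>"
    using gauge_act_commuting_adhm[OF U c x] by (simp add: gauge_act_conj_by B'_def I'_def)
  have Bc: "B' a \<in> carrier_mat k k" if "a \<in> {1..4}" for a
    using x' that by (auto simp: commuting_adhm_def adhm_space_def)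
  have Ic: "I' \<in> carrier_mat k r" using x' by (auto simp: commuting_adhm_def adhm_space_def)
  have comm: "B' a * B' c = B' c * B' a" if "a \<in> {1..4}" for a
    using x' that c by (auto simp: commuting_adhm_def)
  have BI: "B' c * I' = 0\<^sub>m k r" using x' by (auto simp: commuting_adhm_def)
  define H' where "H' = mat_adjoint (B' c) * B' c"
  have Bc'': "mat_adjoint (B' c) \<in> carrier_mat k k" using Bc[OF c] by simp
  have H': "H' = conj_by U H"
    using c by (simp add: H'_def H_def B'_def conj_by_mult[OF U D' Dc] conj_by_adjoint[OF Uc Dc])
  have H'c: "H' \<in> carrier_mat k k" using H Uc by (simp add: H')
  have H'diag: "H' $$ (i, j) = 0" if "i < k" "j < k" "i \<noteq> j" for i j
    using diag H'c that by (simp add: diagonal_mat_def flip: H')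
  have H'mult: "(H' * X) $$ (i, j) = H' $$ (i, i) * X $$ (i, j)"
    if "X \<in> carrier_mat k m" "i < k" "j < m" for X m i j
  proof -
    have "(H' * X) $$ (i, j) = (\<Sum>l<k. H' $$ (i, l) * X $$ (l, j))"
      by (rule mat_mult_index[OF H'c that])
    also have "\<dots> = (\<Sum>l\<in>{i}. H' $$ (i, l) * X $$ (l, j))"
      using that H'diag by (intro sum.mono_neutral_right) auto
    finally show ?thesis by simp
  qed
  \<comment> \<open>By \<open>H'ii\<close>, these are the indices of the zero columns of
    \<open>B' c\<close>, that is, of the basis vectors in its kernel.\<close>
  define J where "J = {i. H' $$ (i, i) = 0}"
  have H'ii: "H' $$ (i, i) = complex_of_real (\<Sum>l<k. (cmod (B' c $$ (l, i)))\<^sup>2)" if "i < k" for i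
    unfolding H'_def using that Bc[OF c]
    by (subst mat_mult_index[OF Bc'' Bc[OF c]])
      (auto simp: complex_norm_square mult.commute simp del: of_real_power)
  have Dcol: "B' c $$ (l, j) = 0" if "j \<in> J" "j < k" "l < k" for j l
  proof -
    have "(\<Sum>l<k. (cmod (B' c $$ (l, j)))\<^sup>2) = 0"
      using that H'ii[OF that(2)] by (simp add: J_def del: of_real_sum of_real_power)
    then show ?thesis using that(3) by (subst (asm) sum_nonneg_eq_0_iff) auto
  qed
  have "{..<k} \<subseteq> J"
  proof (rule invariant_index_set_full[OF commuting_adhm_moment[OF x'] _ \<zeta>])
    fix a i j assume a: "a \<in> {1..4::nat}" and ij: "i < k" "j < k" "i \<notin> J" "j \<in> J"
    \<comment> \<open>Commuting \<open>B' c\<close> past \<open>B' a\<close> puts it on the right,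
      where its column \<open>j\<close> is zero. On the left, entry \<open>(i, j)\<close> is
      \<open>B' a $$ (i, j)\<close> times the nonzero number \<open>H' $$ (i, i)\<close>.\<close>
    have "H' * B' a = mat_adjoint (B' c) * (B' c * B' a)"
      unfolding H'_def by (rule assoc_mult_mat[OF Bc'' Bc[OF c] Bc[OF a]])
    also have "\<dots> = mat_adjoint (B' c) * (B' a * B' c)" by (simp add: comm[OF a])
    also have "\<dots> = mat_adjoint (B' c) * B' a * B' c"
      by (rule assoc_mult_mat[OF Bc'' Bc[OF a] Bc[OF c], symmetric])
    finally have "(H' * B' a) $$ (i, j) = (mat_adjoint (B' c) * B' a * B' c) $$ (i, j)" by simp
    also have "\<dots> = 0"
      using Dcol[OF ij(4,2)] ij
      by (subst mat_mult_index[OF mult_carrier_mat[OF Bc'' Bc[OF a]] Bc[OF c]]) auto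
    finally show "(cmod (B' a $$ (i, j)))\<^sup>2 = 0"
      using H'mult[OF Bc[OF a] ij(1,2)] ij by (simp add: J_def)
  next
    fix i assume i: "i < k" "i \<notin> J"
    have "H' * I' = mat_adjoint (B' c) * (B' c * I')"
      unfolding H'_def by (rule assoc_mult_mat[OF Bc'' Bc[OF c] Ic])
    also have "\<dots> = 0\<^sub>m k r" using Bc'' by (simp add: BI)
    finally have "I' $$ (i, l) = 0" if "l < r" for l
      using H'mult[OF Ic i(1) that] i that by (simp add: J_def)
    then show "(\<Sum>l<r. (cmod (I' $$ (i, l)))\<^sup>2) = 0" by simp
  qed auto
  then have "fro2 (B' c) = 0"
    using Dcol Bc[OF c] by (auto simp: fro2_def intro!: sum.neutral)
  then have "fro2 (B c) = 0" using fro2_conj_by[OF U Dc] c by (simp add: B'_def)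
  then show ?thesis by (rule fro2_eq_0[OF _ Dc])
qed

definition adhm_norm2 :: "adhm \<Rightarrow> real" where
  "adhm_norm2 = (\<lambda>(B, I). (\<Sum>a\<in>{1..4}. fro2 (B a)) + fro2 I)"

lemma adhm_norm2_gauge_act:
  assumes "g \<in> unitary_group k" "x \<in> adhm_space k r"
  shows "adhm_norm2 (gauge_act g x) = adhm_norm2 x"
proof -
  obtain B I where x: "x = (B, I)" by force
  have "fro2 (conj_by g (B a)) = fro2 (B a)" if "a \<in> {1..4}" for a
    using assms(2) that by (intro fro2_conj_by[OF assms(1)]) (auto simp: x adhm_space_def)
  moreover have "fro2 (g * I) = fro2 I"
    using assms(2) by (intro fro2_unitary_mult[OF assms(1)]) (auto simp: x adhm_space_def)
  ultimately show ?thesis by (simp add: x adhm_norm2_def gauge_act_conj_by)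
qed

text \<open>If \<open>n i\<close> is the degree of the \<open>i\<close>-th basis vector, for a grading in which all \<open>B a\<close> raise
  the degree by one and the image of \<open>I\<close> has degree zero, then the trace of the moment map
  equation weighted with \<open>n\<close> reads \<open>\<Sum>a. \<parallel>B a\<parallel>\<^sup>2 = \<zeta> (\<Sum>i. n i)\<close>.\<close>

lemma graded_adhm_norm2:
  assumes x: "(B, I) \<in> commuting_adhm c r k \<zeta>" and \<zeta>: "\<zeta> \<ge> 0"
    and deg: "\<And>a i j. a \<in> {1..4} \<Longrightarrow> i < k \<Longrightarrow> j < k \<Longrightarrow> B a $$ (i, j) \<noteq> 0 \<Longrightarrow> n i = Suc (n j)"
    and deg0: "\<And>i l. i < k \<Longrightarrow> l < r \<Longrightarrow> I $$ (i, l) \<noteq> 0 \<Longrightarrow> n i = 0"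
    and bound: "\<And>i. i < k \<Longrightarrow> n i \<le> k"
  shows "adhm_norm2 (B, I) \<le> \<zeta> * (real k * real k + real k)"
proof -
  let ?b = "\<lambda>a i j. (cmod (B a $$ (i, j)))\<^sup>2"
  let ?w = "\<lambda>i. \<Sum>l<r. (cmod (I $$ (i, l)))\<^sup>2"
  let ?m = "\<lambda>i. \<Sum>a\<in>{1..4}. (\<Sum>j<k. ?b a i j) - (\<Sum>j<k. ?b a j i)"
  note moment = commuting_adhm_moment[OF x]
  have Bc: "B a \<in> carrier_mat k k" if "a \<in> {1..4}" for a
    using x that by (auto simp: commuting_adhm_def adhm_space_def)
  have Ic: "I \<in> carrier_mat k r" using x by (auto simp: commuting_adhm_def adhm_space_def)
  have weighted: "(\<Sum>a\<in>{1..4}. \<Sum>i<k. \<Sum>j<k. (m i - m j) * ?b a i j) + (\<Sum>i<k. m i * ?w i)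
      = \<zeta> * (\<Sum>i<k. m i)" for m :: "nat \<Rightarrow> real"
  proof -
    have "(\<Sum>a\<in>{1..4}. \<Sum>i<k. \<Sum>j<k. (m i - m j) * ?b a i j) + (\<Sum>i<k. m i * ?w i)
        = (\<Sum>i<k. m i * (?m i + ?w i))"
      unfolding sum_weighted_moment[symmetric] by (simp add: distrib_left sum.distrib)
    also have "\<dots> = (\<Sum>i<k. m i * \<zeta>)"
      using moment by (intro sum.cong) auto
    finally show ?thesis by (simp add: sum_distrib_left mult.commute)
  qed
  have "fro2 I = (\<Sum>i<k. ?w i)" using Ic by (simp add: fro2_def)
  \<comment> \<open>For a constant weight the commutators contribute nothing: this is the plain
    trace.\<close>
  also have "\<dots> = \<zeta> * real k" using weighted[of "\<lambda>_. 1"] by simp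
  finally have 1: "fro2 I = \<zeta> * real k" .
  have "(\<Sum>a\<in>{1..4}. fro2 (B a)) = (\<Sum>a\<in>{1..4}. \<Sum>i<k. \<Sum>j<k. ?b a i j)"
    by (intro sum.cong refl) (simp add: fro2_def carrier_matD[OF Bc])
  also have "\<dots> = (\<Sum>a\<in>{1..4}. \<Sum>i<k. \<Sum>j<k. (real (n i) - real (n j)) * ?b a i j)"
  proof (intro sum.cong refl)
    fix a i j assume "a \<in> {1..4::nat}" "i \<in> {..<k}" "j \<in> {..<k}"
    then show "?b a i j = (real (n i) - real (n j)) * ?b a i j"
      using deg[of a i j] by (cases "B a $$ (i, j) = 0") auto
  qed
  also have "\<dots> = \<zeta> * (\<Sum>i<k. real (n i))"
  proof -
    have "(\<Sum>i<k. real (n i) * ?w i) = 0"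
    proof (rule sum.neutral, rule ballI)
      fix i assume i: "i \<in> {..<k}"
      show "real (n i) * ?w i = 0"
      proof (cases "n i = 0")
        case False
        then have "\<forall>l\<in>{..<r}. I $$ (i, l) = 0" using deg0[of i] i by auto
        then show ?thesis by simp
      qed simp
    qed
    then show ?thesis using weighted[of "\<lambda>i. real (n i)"] by simp
  qed
  \<comment> \<open>Each of the \<open>k\<close> degrees is estimated crudely by \<open>k\<close>,
    which is the origin of the quadratic term.\<close>
  also have "\<dots> \<le> \<zeta> * (\<Sum>i<k. real k)"
    using bound by (intro mult_left_mono sum_mono \<zeta>) auto
  finally have "(\<Sum>a\<in>{1..4}. fro2 (B a)) \<le> \<zeta> * (real k * real k)" by simp
  with 1 show ?thesis by (simp add: adhm_norm2_def distrib_left)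
qed

text \<open>Used with \<open>m = Suc k\<close>: there are more powers than eigenvalues, and an
  exponent up to \<open>k\<close> is determined by its power.\<close>

lemma root_of_unity_powers_inj:
  assumes "m > 0"
  obtains u :: complex where "cmod u = 1" "inj_on (\<lambda>n. u ^ n) {..<m}"
proof
  let ?u = "cis (2 * pi / real m)"
  show "cmod ?u = 1" by simp
  have "?u ^ n = cis (2 * pi * real n / real m)" for n
    by (simp add: DeMoivre field_simps)
  then show "inj_on (\<lambda>n. ?u ^ n) {..<m}"
    using bij_betw_roots_unity[OF assms] by (simp add: bij_betw_def)
qed

text \<open>A unitary \<open>g\<close> that implements the scaling by a primitive \<open>(k + 1)\<close>-th root of unity grades
  \<open>V\<close> by its eigenspaces. One of the \<open>k + 1\<close> possible eigenspaces of the \<open>k\<close>-dimensional space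
  vanishes, and stability confines \<open>V\<close> to the degrees below it.\<close>

lemma scaling_invariant_adhm_norm2:
  assumes x: "(B, I) \<in> commuting_adhm c r k \<zeta>" and c: "c \<in> {1..4}" and \<zeta>: "\<zeta> > 0"
    and u: "cmod u = 1" "inj_on (\<lambda>n. u ^ n) {..<Suc k}"
    and g: "g \<in> unitary_group k"
    and scale: "\<And>a. a \<in> {1..4} - {c} \<Longrightarrow> conj_by g (B a) = u \<cdot>\<^sub>m B a"
    and fixes_I: "g * I = I"
  shows "adhm_norm2 (B, I) \<le> \<zeta> * (real k * real k + real k)"
proof -
  note gc = unitary_groupD(1)[OF g]
  have "g * mat_adjoint g = mat_adjoint g * g" using unitary_groupD[OF g] by simp
  then obtain U where U: "U \<in> unitary_group k" and diag: "diagonal_mat (conj_by U g)"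
    using normal_unitarily_diagonalisable[OF gc] by metis
  note Uc = unitary_groupD(1)[OF U]
  have U'c: "mat_adjoint U \<in> carrier_mat k k" using Uc by simp
  have B0c: "B a \<in> carrier_mat k k" if "a \<in> {1..4}" for a
    using x that by (auto simp: commuting_adhm_def adhm_space_def)
  have I0c: "I \<in> carrier_mat k r" using x by (auto simp: commuting_adhm_def adhm_space_def)
  define h where "h = conj_by U g"
  have hc: "h \<in> carrier_mat k k" using Uc gc by (simp add: h_def)
  have h: "h \<in> unitary_group k"
    unfolding h_def conj_by_def by (intro unitary_mult U g adjoint_in_unitary_group)
  define B' where "B' = (\<lambda>a\<in>{1..4}. conj_by U (B a))"
  define I' where "I' = U * I"
  have x': "(B', I') \<in> commuting_adhm c r k \<zeta>"
    using gauge_act_commuting_adhm[OF U c x] by (simp add: gauge_act_conj_by B'_def I'_def)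
  have Bc: "B' a \<in> carrier_mat k k" if "a \<in> {1..4}" for a
    using x' that by (auto simp: commuting_adhm_def adhm_space_def)
  have Ic: "I' \<in> carrier_mat k r" using x' by (auto simp: commuting_adhm_def adhm_space_def)
  have hdiag: "h $$ (i, j) = 0" if "i < k" "j < k" "i \<noteq> j" for i j
    using diag hc that by (simp add: diagonal_mat_def flip: h_def)
  define d where "d i = h $$ (i, i)" for i
  have hmult: "(h * X) $$ (i, j) = d i * X $$ (i, j)"
    if "X \<in> carrier_mat k m" "i < k" "j < m" for X m i j
  proof -
    have "(h * X) $$ (i, j) = (\<Sum>l<k. h $$ (i, l) * X $$ (l, j))"
      by (rule mat_mult_index[OF hc that])
    also have "\<dots> = (\<Sum>l\<in>{i}. h $$ (i, l) * X $$ (l, j))"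
      using that hdiag by (intro sum.mono_neutral_right) auto
    finally show ?thesis by (simp add: d_def)
  qed
  have multh: "(X * h) $$ (i, j) = X $$ (i, j) * d j"
    if "X \<in> carrier_mat k k" "i < k" "j < k" for X i j
  proof -
    have "(X * h) $$ (i, j) = (\<Sum>l<k. X $$ (i, l) * h $$ (l, j))"
      by (rule mat_mult_index[OF that(1) hc that(2,3)])
    also have "\<dots> = (\<Sum>l\<in>{j}. X $$ (i, l) * h $$ (l, j))"
      using that hdiag by (intro sum.mono_neutral_right) auto
    finally show ?thesis by (simp add: d_def)
  qed
  \<comment> \<open>The relation g B_a = u B_a g, carried to the eigenbasis of \<open>g\<close>.
    Comparing entries shows that \<open>B' a\<close> multiplies eigenvalues by
    \<open>u\<close>.\<close>
  have hB: "h * B' a = u \<cdot>\<^sub>m B' a * h" if a: "a \<in> {1..4} - {c}" for a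
  proof -
    have a': "a \<in> {1..4}" using a by auto
    have "g * B a = conj_by g (B a) * g"
      unfolding conj_by_def
      by (rule unitary_cancel(4)[OF g gc mult_carrier_mat[OF gc B0c[OF a']], symmetric])
    then have "conj_by U (g * B a) = conj_by U (u \<cdot>\<^sub>m B a * g)" by (simp add: scale[OF a])
    then show ?thesis
      using a' by (simp add: conj_by_mult[OF U] gc B0c[OF a'] smult_carrier_mat conj_by_smult[OF Uc] h_def B'_def)
  qed
  have hI: "h * I' = I'"
  proof -
    have "h * I' = U * g * (mat_adjoint U * (U * I))"
      unfolding h_def I'_def conj_by_def
      by (rule assoc_mult_mat[OF mult_carrier_mat[OF Uc gc] U'c mult_carrier_mat[OF Uc I0c]])
    also have "\<dots> = U * (g * I)"
      by (simp add: unitary_cancel(1)[OF U I0c Uc] assoc_mult_mat[OF Uc gc I0c])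
    finally show ?thesis by (simp add: fixes_I I'_def)
  qed
  have d0: "d j \<noteq> 0" if "j < k" for j
    using hmult[of "mat_adjoint h" k j j] that unitary_groupD(2)[OF h] hc by auto
  \<comment> \<open>The scaling assumption leaves out the index \<open>c\<close>; as this matrix
    vanishes, \<open>dB\<close> holds for all four indices.\<close>
  have B'0: "B' c = 0\<^sub>m k k" by (rule commuting_adhm_missing_zero[OF x' c \<zeta>])
  have dB: "d i = u * d j" if a: "a \<in> {1..4}" and ij: "i < k" "j < k" and nz: "B' a $$ (i, j) \<noteq> 0" for a i j
  proof -
    have "a \<noteq> c" using nz ij B'0 by auto
    then have "(h * B' a) $$ (i, j) = (u \<cdot>\<^sub>m B' a * h) $$ (i, j)" using a by (simp add: hB)
    then show ?thesis
      using nz ij Bc[OF a] by (simp add: hmult[OF Bc[OF a] ij] multh[OF smult_carrier_mat[OF Bc[OF a]] ij])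
  qed
  have dI: "d i = 1" if "i < k" "l < r" "I' $$ (i, l) \<noteq> 0" for i l
    using hmult[OF Ic that(1,2)] that(3) by (simp add: hI)
  \<comment> \<open>Pigeonhole: otherwise the \<open>k + 1\<close> distinct powers would be attained
    at distinct indices below \<open>k\<close>.\<close>
  obtain n where n: "n \<le> k" and empty: "\<And>i. i < k \<Longrightarrow> d i \<noteq> u ^ n"
  proof (rule ccontr)
    assume "\<not> thesis"
    then have "\<forall>n\<in>{..<Suc k}. \<exists>i<k. d i = u ^ n" using that less_Suc_eq_le by blast
    then obtain f where f: "\<And>n. n < Suc k \<Longrightarrow> f n < k \<and> d (f n) = u ^ n" by (metis lessThan_iff)
    have "inj_on f {..<Suc k}"
    proof (rule inj_onI)
      fix p q assume pq: "p \<in> {..<Suc k}" "q \<in> {..<Suc k}" "f p = f q"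
      then have "u ^ p = u ^ q" using f[of p] f[of q] by auto
      then show "p = q" using u(2) pq by (auto dest: inj_onD)
    qed
    moreover have "f ` {..<Suc k} \<subseteq> {..<k}" using f by auto
    ultimately have "card {..<Suc k} \<le> card {..<k}" using card_inj_on_le by blast
    then show False by simp
  qed
  define J where "J = {i. \<exists>m<n. d i = u ^ m}"
  have step: "i \<in> J"
    if a: "a \<in> {1..4}" and ij: "i < k" "j < k" "j \<in> J" and nz: "B' a $$ (i, j) \<noteq> 0" for a i j
  proof -
    obtain m where m: "m < n" "d j = u ^ m" using ij(3) by (auto simp: J_def)
    then have "d i = u ^ Suc m" using dB[OF a ij(1,2) nz] by simp
    \<comment> \<open>Raising the degree from \<open>m < n\<close> could leave \<open>J\<close> only
      by reaching the empty degree \<open>n\<close>.\<close>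
    moreover from this have "Suc m \<noteq> n" using empty[OF ij(1)] by auto
    ultimately show ?thesis using m(1) using Suc_lessI[of m n] unfolding J_def by blast
  qed
  have start: "i \<in> J" if "i < k" "l < r" "I' $$ (i, l) \<noteq> 0" for i l
  proof -
    have "d i = u ^ 0" using dI[OF that] by simp
    moreover have "n \<noteq> 0" using empty[OF that(1)] dI[OF that] by (intro notI) simp
    ultimately show ?thesis unfolding J_def by blast
  qed
  have full: "{..<k} \<subseteq> J"
  proof (rule invariant_index_set_full[OF commuting_adhm_moment[OF x'] _ \<zeta>])
    fix a i j assume "a \<in> {1..4::nat}" "i < k" "j < k" "i \<notin> J" "j \<in> J"
    then show "(cmod (B' a $$ (i, j)))\<^sup>2 = 0" using step[of a i j] by auto
  next
    fix i assume "i < k" "i \<notin> J"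
    then show "(\<Sum>l<r. (cmod (I' $$ (i, l)))\<^sup>2) = 0" using start by (intro sum.neutral) auto
  qed auto
  then have "\<forall>i<k. \<exists>m<n. d i = u ^ m" by (auto simp: J_def)
  then obtain deg where deg: "\<And>i. i < k \<Longrightarrow> deg i < n \<and> d i = u ^ deg i" by metis
  have "adhm_norm2 (B', I') \<le> \<zeta> * (real k * real k + real k)"
  proof (rule graded_adhm_norm2[OF x', where n = deg])
    fix a i j assume a: "a \<in> {1..4::nat}" and ij: "i < k" "j < k" and nz: "B' a $$ (i, j) \<noteq> 0"
    \<comment> \<open>Both exponents are at most \<open>n \<le> k\<close>, so they lie in the range
      where powers of \<open>u\<close> are distinct.\<close>
    have "u ^ deg i = u ^ Suc (deg j)" using dB[OF a ij nz] deg[OF ij(1)] deg[OF ij(2)] by simp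
    then show "deg i = Suc (deg j)"
      using deg[OF ij(1)] deg[OF ij(2)] n by (intro inj_onD[OF u(2)]) auto
  next
    fix i l assume il: "i < k" "l < r" "I' $$ (i, l) \<noteq> 0"
    have "u ^ deg i = u ^ 0" using dI[OF il] deg[OF il(1)] by simp
    then show "deg i = 0" using deg[OF il(1)] n by (intro inj_onD[OF u(2)]) auto
  next
    fix i assume "i < k"
    then show "deg i \<le> k" using deg n by fastforce
  qed (use \<zeta> in auto)
  also have "adhm_norm2 (B', I') = adhm_norm2 (B, I)"
    using adhm_norm2_gauge_act[OF U, of "(B, I)" r] x
    by (simp add: gauge_act_conj_by B'_def I'_def commuting_adhm_def)
  finally show ?thesis .
qed

section \<open>From a fixed orbit to a bounded representative\<close>

text \<open>Membership in the space makes \<open>B\<close> extensional, so the restriction to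
  \<open>{1..4}\<close> inside \<open>gauge_act\<close> changes nothing.\<close>

lemma gauge_act_one:
  assumes "x \<in> adhm_space k r"
  shows "gauge_act (1\<^sub>m k) x = x"
proof -
  obtain B I where x: "x = (B, I)" by force
  have "(\<lambda>a\<in>{1..4}. conj_by (1\<^sub>m k) (B a)) a = B a" for a
  proof (cases "a \<in> {1..4}")
    case True
    then have "B a \<in> carrier_mat k k" using assms by (auto simp: x adhm_space_def)
    with True show ?thesis by (simp add: conj_by_def)
  next
    case False
    then show ?thesis using assms by (auto simp: x adhm_space_def PiE_iff extensional_def)
  qed
  moreover have "1\<^sub>m k * I = I" using assms by (auto simp: x adhm_space_def)
  ultimately show ?thesis by (simp add: x gauge_act_conj_by fun_eq_iff)
qed

lemma invariant_moduli_space_bounded: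
  assumes A: "A \<in> {{1, 2, 3}, {1, 2, 4}, {1, 3, 4}, {2, 3, 4}}" and \<zeta>: "\<zeta> > 0"
    and X: "X \<in> invariant_moduli_space A r k \<zeta>"
  obtains x where "x \<in> adhm_space k r" "adhm_norm2 x \<le> \<zeta> * (real k * real k + real k)" "X = adhm_orbit k x"
proof -
  define c where "c = missing_index A"
  have c: "c \<in> {1..4}" "{1..4} - {c} \<subseteq> A"
  proof -
    have "{1..4} - {4} = {1, 2, 3::nat}" "{1..4} - {3} = {1, 2, 4::nat}"
      "{1..4} - {2} = {1, 3, 4::nat}" "{1..4} - {1} = {2, 3, 4::nat}"
      by auto
    moreover have "4 \<in> {1..4::nat}" "3 \<in> {1..4::nat}" "2 \<in> {1..4::nat}" "1 \<in> {1..4::nat}" by auto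
    ultimately obtain e where e: "e \<in> {1..4}" "A = {1..4} - {e}"
      using A by (elim insertE emptyE) metis+
    then have "c = e" unfolding c_def missing_index_def by (intro the_equality) auto
    with e show "c \<in> {1..4}" "{1..4} - {c} \<subseteq> A" by auto
  qed
  obtain B I where sol: "(B, I) \<in> adhm_solutions A r k \<zeta>" and X_def: "X = adhm_orbit k (B, I)"
    using X by (auto simp: invariant_moduli_space_def moduli_space_def)
  have x: "(B, I) \<in> commuting_adhm c r k \<zeta>" unfolding c_def by (rule adhm_solutions_commuting[OF sol])
  have sp: "(B, I) \<in> adhm_space k r" using sol by (auto simp: adhm_solutions_def)
  have Bc: "B a \<in> carrier_mat k k" if "a \<in> {1..4}" for a using sp that by (auto simp: adhm_space_def)
  have Ic: "I \<in> carrier_mat k r" using sp by (auto simp: adhm_space_def)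
  obtain u :: complex where u: "cmod u = 1" "inj_on (\<lambda>n. u ^ n) {..<Suc k}"
    using root_of_unity_powers_inj[of "Suc k"] by auto
  have "(1\<^sub>m r, inverse u) \<in> torus r"
    using u(1) by (auto simp: torus_def diagonal_mat_def norm_inverse)
  \<comment> \<open>The torus acts by \<open>inverse t\<close> on the indices in \<open>A\<close>,
    so \<open>t = inverse u\<close> scales these matrices by \<open>u\<close>; the identity framing
    leaves \<open>I\<close> alone.\<close>
  then have inv: "torus_act A (1\<^sub>m r, inverse u) ` X = X"
    using X by (auto simp: invariant_moduli_space_def)
  have "gauge_act (1\<^sub>m k) (B, I) \<in> X" unfolding X_def adhm_orbit_def by simp
  moreover have "gauge_act (1\<^sub>m k) (B, I) = (B, I)" by (rule gauge_act_one[OF sp])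
  ultimately have "torus_act A (1\<^sub>m r, inverse u) (B, I) \<in> X" using inv by (metis imageI)
  \<comment> \<open>The transformed datum lies in the orbit of \<open>(B, I)\<close>, so some gauge
    transformation has the same effect on it.\<close>
  then obtain g where g: "g \<in> unitary_group k"
    and eq: "torus_act A (1\<^sub>m r, inverse u) (B, I) = gauge_act g (B, I)"
    by (auto simp: X_def adhm_orbit_def)
  have "g * I = I" using eq Ic by (simp add: torus_act_def gauge_act_conj_by)
  moreover have "conj_by g (B a) = u \<cdot>\<^sub>m B a" if "a \<in> {1..4} - {c}" for a
  proof -
    have a: "a \<in> {1..4}" "a \<in> A" using that c by auto
    have "fst (torus_act A (1\<^sub>m r, inverse u) (B, I)) a = fst (gauge_act g (B, I)) a" by (simp add: eq)
    then show ?thesis using a by (simp add: torus_act_def gauge_act_conj_by)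
  qed
  ultimately have "adhm_norm2 (B, I) \<le> \<zeta> * (real k * real k + real k)"
    by (intro scaling_invariant_adhm_norm2[OF x c(1) \<zeta> u g]) auto
  with sp X_def show ?thesis using that by blast
qed

section \<open>Compactness in the orbit space\<close>

lemma frob_dist_zero:
  assumes "X \<in> carrier_mat m n"
  shows "(frob_dist m n (0\<^sub>m m n) X)\<^sup>2 = fro2 X"
  using assms by (simp add: frob_dist_def fro2_def sum_nonneg)

definition adhm_zero :: "nat \<Rightarrow> nat \<Rightarrow> adhm" where
  "adhm_zero k r = ((\<lambda>a\<in>{1..4}. 0\<^sub>m k k), 0\<^sub>m k r)"

lemma adhm_zero_space: "adhm_zero k r \<in> adhm_space k r"
  by (auto simp: adhm_zero_def adhm_space_def)

lemma adhm_dist_zero: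
  assumes "x \<in> adhm_space k r"
  shows "adhm_dist k r (adhm_zero k r) x = sqrt (adhm_norm2 x)"
proof -
  obtain B I where x: "x = (B, I)" by force
  have "(\<Sum>a\<in>{1..4}. (frob_dist k k ((\<lambda>a\<in>{1..4}. 0\<^sub>m k k) a) (B a))\<^sup>2) = (\<Sum>a\<in>{1..4}. fro2 (B a))"
    using assms by (intro sum.cong refl) (auto simp: x adhm_space_def frob_dist_zero PiE_iff)
  moreover have "(frob_dist k r (0\<^sub>m k r) I)\<^sup>2 = fro2 I"
    using assms by (intro frob_dist_zero) (auto simp: x adhm_space_def)
  ultimately show ?thesis by (simp add: x adhm_zero_def adhm_dist_def adhm_norm2_def)
qed

lemma closedin_adhm_ball: "closedin (adhm_topology k r) {x \<in> adhm_space k r. adhm_norm2 x \<le> R}"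
proof -
  interpret Metric_space "adhm_space k r" "adhm_dist k r" by (rule Metric_space_adhm)
  have "{x \<in> adhm_space k r. adhm_norm2 x \<le> R} = mcball (adhm_zero k r) (sqrt R)"
    using adhm_zero_space by (auto simp: mcball_def adhm_dist_zero)
  then show ?thesis by (simp add: adhm_topology_def)
qed

text \<open>First index 0 encodes \<open>I\<close>, and 1 to 4 encode the \<open>B a\<close>.
  Functions on all triples form a full product, to which Tychonoff's theorem applies; surplus
  coordinates are dropped.\<close>

definition adhm_of_entries :: "nat \<Rightarrow> nat \<Rightarrow> (nat \<times> nat \<times> nat \<Rightarrow> complex) \<Rightarrow> adhm" where
  "adhm_of_entries k r f =
    ((\<lambda>a\<in>{1..4}. mat k k (\<lambda>(i, j). f (a, i, j))), mat k r (\<lambda>(i, j). f (0, i, j)))"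

lemma adhm_of_entries_space: "adhm_of_entries k r f \<in> adhm_space k r"
  by (auto simp: adhm_of_entries_def adhm_space_def)

lemma adhm_dist_of_entries:
  "adhm_dist k r (adhm_of_entries k r f) (adhm_of_entries k r g) =
    sqrt ((\<Sum>a\<in>{1..4}. \<Sum>i<k. \<Sum>j<k. (cmod (f (a, i, j) - g (a, i, j)))\<^sup>2)
      + (\<Sum>i<k. \<Sum>j<r. (cmod (f (0, i, j) - g (0, i, j)))\<^sup>2))"
  by (simp add: adhm_dist_def adhm_of_entries_def frob_dist_def sum_nonneg)

text \<open>The distance depends on finitely many coordinates, so it is continuous in the product
  topology.\<close>

lemma continuous_map_adhm_of_entries:
  "continuous_map euclidean (adhm_topology k r) (adhm_of_entries k r)"
proof -
  interpret Metric_space "adhm_space k r" "adhm_dist k r" by (rule Metric_space_adhm)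
  have "\<exists>U. openin euclidean U \<and> f \<in> U \<and> (\<forall>g\<in>U. adhm_of_entries k r g \<in> mball (adhm_of_entries k r f) e)"
    if e: "e > 0" for f :: "nat \<times> nat \<times> nat \<Rightarrow> complex" and e :: real
  proof -
    let ?h = "\<lambda>g. adhm_dist k r (adhm_of_entries k r f) (adhm_of_entries k r g)"
    have "continuous_on UNIV ?h"
      unfolding adhm_dist_of_entries
      by (intro continuous_intros continuous_on_product_coordinates)
    then have "open {g. ?h g < e}" by (intro open_Collect_less) auto
    moreover have "f \<in> {g. ?h g < e}" using e adhm_of_entries_space by simp
    ultimately show ?thesis using adhm_of_entries_space
      by (intro exI[of _ "{g. ?h g < e}"]) auto
  qed
  then show ?thesis unfolding adhm_topology_def continuous_map_to_metric by simp
qed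

lemma compactin_adhm_ball: "compactin (adhm_topology k r) {x \<in> adhm_space k r. adhm_norm2 x \<le> R}"
proof -
  define K :: "(nat \<times> nat \<times> nat \<Rightarrow> complex) set" where "K = PiE UNIV (\<lambda>_. cball 0 (sqrt R))"
  have "compactin (product_topology (\<lambda>_. euclidean) UNIV) K"
    unfolding K_def by (subst compactin_PiE) auto
  then have "compactin euclidean K" by (simp add: euclidean_product_topology)
  then have "compactin (adhm_topology k r) (adhm_of_entries k r ` K)"
    by (rule image_compactin[OF _ continuous_map_adhm_of_entries])
  moreover have "{x \<in> adhm_space k r. adhm_norm2 x \<le> R} \<subseteq> adhm_of_entries k r ` K"
  proof
    fix x assume x: "x \<in> {x \<in> adhm_space k r. adhm_norm2 x \<le> R}"
    obtain B I where x_def: "x = (B, I)" by force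
    have Bc: "B a \<in> carrier_mat k k" if "a \<in> {1..4}" for a using x that by (auto simp: x_def adhm_space_def)
    have Ic: "I \<in> carrier_mat k r" using x by (auto simp: x_def adhm_space_def)
    have N: "(\<Sum>a\<in>{1..4}. fro2 (B a)) + fro2 I \<le> R" using x by (simp add: x_def adhm_norm2_def)
    have S: "(\<Sum>a\<in>{1..4}. fro2 (B a)) \<ge> 0" by (intro sum_nonneg fro2_nonneg)
    have R: "R \<ge> 0" using N S fro2_nonneg[of I] by linarith
    have entry: "cmod (X $$ (i, j)) \<le> sqrt R" if "fro2 X \<le> R" "i < dim_row X" "j < dim_col X" for X i j
    proof -
      have "(cmod (X $$ (i, j)))\<^sup>2 \<le> (\<Sum>j<dim_col X. (cmod (X $$ (i, j)))\<^sup>2)"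
        using that by (intro member_le_sum) auto
      also have "\<dots> \<le> fro2 X"
        unfolding fro2_def using that
        by (intro member_le_sum[of i _ "\<lambda>i. \<Sum>j<dim_col X. (cmod (X $$ (i, j)))\<^sup>2"]) (auto intro: sum_nonneg)
      finally show ?thesis using that(1) by (intro real_le_rsqrt) linarith
    qed
    have "fro2 (B a) \<le> R" if "a \<in> {1..4}" for a
    proof -
      have "fro2 (B a) \<le> (\<Sum>a\<in>{1..4}. fro2 (B a))"
        by (intro member_le_sum that fro2_nonneg) auto
      with N fro2_nonneg[of I] show ?thesis by linarith
    qed
    then have BR: "cmod (B a $$ (i, j)) \<le> sqrt R" if "a \<in> {1..4}" "i < k" "j < k" for a i j
      using that Bc[OF that(1)] by (intro entry) auto
    have "fro2 I \<le> R" using N S by linarith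
    then have IR: "cmod (I $$ (i, j)) \<le> sqrt R" if "i < k" "j < r" for i j
      using that Ic by (intro entry) auto
    \<comment> \<open>Surplus coordinates are set to 0, which lies in the disc because
      \<open>R \<ge> 0\<close>.\<close>
    define f where "f = (\<lambda>(a, i, j). if a = 0 then (if i < k \<and> j < r then I $$ (i, j) else 0)
      else if a \<in> {1..4} \<and> i < k \<and> j < k then B a $$ (i, j) else 0)"
    have "f \<in> K" using BR IR R by (auto simp: K_def f_def)
    moreover have "adhm_of_entries k r f = x"
    proof -
      have "(\<lambda>a\<in>{1..4}. mat k k (\<lambda>(i, j). f (a, i, j))) a = B a" for a
      proof (cases "a \<in> {1..4}")
        case True
        then show ?thesis using Bc[OF True] by (auto simp: f_def intro!: eq_matI)
      next
        case False
        then show ?thesis using x by (auto simp: x_def adhm_space_def PiE_iff extensional_def)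
      qed
      moreover have "mat k r (\<lambda>(i, j). f (0, i, j)) = I"
        using Ic by (intro eq_matI) (auto simp: f_def)
      ultimately show ?thesis by (simp add: adhm_of_entries_def x_def fun_eq_iff)
    qed
    ultimately show "x \<in> adhm_of_entries k r ` K" by blast
  qed
  \<comment> \<open>The image of the polydisc contains the ball, which is closed and so inherits
    compactness.\<close>
  ultimately show ?thesis by (rule closed_compactin[OF _ _ closedin_adhm_ball])
qed

theorem propositionB8:
  fixes A :: "nat set" and r k :: nat and \<zeta> :: real
  assumes "A \<in> {{1, 2, 3}, {1, 2, 4}, {1, 3, 4}, {2, 3, 4}}"
    and "r \<ge> 1"
    and "\<zeta> > 0"
  shows "compactin (orbit_topology k r)
           ((orbit_topology k r) closure_of (invariant_moduli_space A r k \<zeta>))"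
proof -
  define C where "C = {x \<in> adhm_space k r. adhm_norm2 x \<le> \<zeta> * (real k * real k + real k)}"
  \<comment> \<open>The norm is constant on orbits, so \<open>C\<close> is a union of orbits and its
    closedness descends along the quotient map.\<close>
  have saturated: "{x \<in> topspace (adhm_topology k r). adhm_orbit k x \<in> adhm_orbit k ` C} = C"
  proof (intro equalityI subsetI)
    fix x assume "x \<in> {x \<in> topspace (adhm_topology k r). adhm_orbit k x \<in> adhm_orbit k ` C}"
    then obtain y where x: "x \<in> adhm_space k r" and y: "y \<in> C" "adhm_orbit k x = adhm_orbit k y"
      by (auto simp: topspace_adhm_topology)
    have "x \<in> adhm_orbit k x"
      unfolding adhm_orbit_def using gauge_act_one[OF x] by (metis imageI one_in_unitary_group)
    then obtain g where "g \<in> unitary_group k" "x = gauge_act g y"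
      unfolding y(2) by (auto simp: adhm_orbit_def)
    then show "x \<in> C" using x y(1) adhm_norm2_gauge_act[of g k y r] by (simp add: C_def)
  qed (auto simp: C_def topspace_adhm_topology)
  have "adhm_orbit k ` C \<subseteq> topspace (orbit_topology k r)"
    by (auto simp: topspace_orbit_topology C_def)
  moreover have "closedin (adhm_topology k r) {x \<in> topspace (adhm_topology k r). adhm_orbit k x \<in> adhm_orbit k ` C}"
    unfolding saturated unfolding C_def by (rule closedin_adhm_ball)
  ultimately have "closedin (orbit_topology k r) (adhm_orbit k ` C)"
    using quotient_map_adhm_orbit[of k r] unfolding quotient_map_closedin by blast
  moreover have "invariant_moduli_space A r k \<zeta> \<subseteq> adhm_orbit k ` C"
    using invariant_moduli_space_bounded[OF assms(1,3)] by (force simp: C_def)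
  ultimately have "orbit_topology k r closure_of invariant_moduli_space A r k \<zeta> \<subseteq> adhm_orbit k ` C"
    by (intro closure_of_minimal)
  moreover have "compactin (orbit_topology k r) (adhm_orbit k ` C)"
    unfolding C_def
    by (intro image_compactin[OF compactin_adhm_ball] quotient_imp_continuous_map quotient_map_adhm_orbit)
  ultimately show ?thesis
    using closed_compactin[OF _ _ closedin_closure_of] by blast
qed

end
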